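(* Let $(X,\mu,T)$ be a computable measure-preserving system and $n\ge 1$. Let $f:\subseteq X\to[-\infty,\infty]$ be $n$-computable, defined almost everywhere, and integrable. Then for all $n$-random $x\in\bigcap_{k\ge 0}T^{-k}(\operatorname{dom}f)$, the limit $\lim_{N\to\infty}A_Nf(x)$ exists, where $A_Nf(x)=\frac1N\sum_{k<N}f(T^k(x))$.
   Context: Uniformity: a sequence of objects has a property (whose definition involves an index in $\mathbb N$) uniformly if a computable function produces suitable indices. A computable metric space is a triple $(X,d,S)$ where $(X,d)$ is a complete separable metric space, $S=(s_i)_i$ is a dense sequence in $X$, and $d(s_i,s_j)$ is a computable real number uniformly in $i,j$. With $(q_j)_j$ a fixed enumeration of the positive rationals and $\langle\cdot,\cdot\rangle$ the standard pairing function, the ideal balls are $B_{\langle i,j\rangle}=\{x\in X: d(x,s_i)<q_j\}$. A set $U\subseteq X$ is $\Sigma^0_1$ if $U=\bigcup_{i\in W}B_i$ for some c.e. $W\subseteq\mathbb N$ (its index is an index of $W$). A set is $\Pi^0_n$ if its complement is $\Sigma^0_n$. A set is $\Sigma^0_{n+1}$ if it equals $\bigcup_{i\in W}(X\setminus U^n_i)$ for some c.e. $W\subseteq\mathbb N$, where $U^n_i$ is the $i$-th $\Sigma^0_n$ set. For $D\subseteq X$, a subset of $D$ is $\Sigma^0_n$ in $D$ if it is the intersection of $D$ with a $\Sigma^0_n$ subset of $X$. A computable probability space $(X,\mu)$ is a computable metric space with a Borel probability measure $\mu$ such that $\mu(\bigcup_{i\in F}B_i)$ is lower-semicomputable uniformly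 in finite $F\subseteq\mathbb N$. A measure-preserving transformation is a partial Borel measurable map $T:\subseteq X\to X$ such that $\mu(T^{-1}(B))=\mu(B)$ for every Borel $B$ (so $\operatorname{dom}T$ has full measure) and $x\in\operatorname{dom}T$ implies $T(x)\in\operatorname{dom}T$. It is computable if the sets $T^{-1}(B_i)$ are uniformly $\Sigma^0_1$ in $\operatorname{dom}T$. A computable measure-preserving system $(X,\mu,T)$ is a computable probability space with a computable measure-preserving transformation. A partial function $f:\subseteq X\to[-\infty,\infty]$ is $n$-computable if both $\{x\in\operatorname{dom}f:f(x)>q\}$ and $\{x\in\operatorname{dom}f:f(x)<q\}$ are $\Sigma^0_n$ in $\operatorname{dom}f$, uniformly in $q\in\mathbb Q$. An $n$-test is a sequence $(U_k)_k$ of uniformly $\Sigma^0_n$ sets with $\mu(U_k)\le2^{-k}$ for all $k$; $x$ is $n$-random if $x\notin\bigcap_kU_k$ for every $n$-test. *)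

theory Defs
  imports "HOL-Probability.Probability" "HOL-Library.Nat_Bijection"
begin

text \<open>
  The partial recursive functions of one argument, with several arguments packed by the
  Cantor pairing function \<^const>\<open>prod_encode\<close>.  \<open>Prec p q\<close> recurses on the second component
  of its argument; the step function \<open>q\<close> is applied to \<open>\<langle>x, \<langle>m, previous value\<rangle>\<rangle>\<close>.
  \<open>Mu p\<close> maps \<open>x\<close> to the least \<open>m\<close> with \<open>p \<langle>x, m\<rangle> = 0\<close>, where \<open>p\<close> has to be defined at all
  \<open>\<langle>x, i\<rangle>\<close> with \<open>i < m\<close>.
\<close>

datatype prog =
    Zero
  | Succ
  | Fst
  | Snd
  | Pair prog prog
  | Comp prog prog
  | Prec prog prog
  | Mu prog

inductive evals :: "prog \<Rightarrow> nat \<Rightarrow> nat \<Rightarrow> bool" where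
  Zero: "evals Zero x 0"
| Succ: "evals Succ x (Suc x)"
| Fst: "evals Fst (prod_encode (x, y)) x"
| Snd: "evals Snd (prod_encode (x, y)) y"
| Pair: "evals p x y \<Longrightarrow> evals q x z \<Longrightarrow> evals (Pair p q) x (prod_encode (y, z))"
| Comp: "evals q x y \<Longrightarrow> evals p y z \<Longrightarrow> evals (Comp p q) x z"
| Prec_0: "evals p x y \<Longrightarrow> evals (Prec p q) (prod_encode (x, 0)) y"
| Prec_Suc: "evals (Prec p q) (prod_encode (x, m)) y \<Longrightarrow>
    evals q (prod_encode (x, prod_encode (m, y))) z \<Longrightarrow>
    evals (Prec p q) (prod_encode (x, Suc m)) z"
| Mu: "evals p (prod_encode (x, m)) 0 \<Longrightarrow>
    (\<forall>i<m. \<exists>y. evals p (prod_encode (x, i)) (Suc y)) \<Longrightarrow>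
    evals (Mu p) x m"

text \<open>
  Goedel numbering; it has to be given explicitly, since the injection provided by the
  class \<^class>\<open>countable\<close> is obtained by choice and need not be effective.
\<close>

primrec godel :: "prog \<Rightarrow> nat" where
  "godel Zero = 0"
| "godel Succ = 1"
| "godel Fst = 2"
| "godel Snd = 3"
| "godel (Pair p q) = 4 * prod_encode (godel p, godel q) + 4"
| "godel (Comp p q) = 4 * prod_encode (godel p, godel q) + 5"
| "godel (Prec p q) = 4 * prod_encode (godel p, godel q) + 6"
| "godel (Mu p) = 4 * godel p + 7"

lemma godel_inject: "godel p = godel q \<longleftrightarrow> p = q"
proof
  show "p = q" if "godel p = godel q"
    using that
  proof (induction p arbitrary: q)
    case Zero then show ?case by (cases q) auto
  next
    case Succ then show ?case by (cases q) auto
  next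
    case Fst then show ?case by (cases q) auto
  next
    case Snd then show ?case by (cases q) auto
  next
    case (Pair p1 p2) from Pair.prems show ?case by (cases q) (auto dest: Pair.IH, presburger+)
  next
    case (Comp p1 p2) from Comp.prems show ?case by (cases q) (auto dest: Comp.IH, presburger+)
  next
    case (Prec p1 p2) from Prec.prems show ?case by (cases q) (auto dest: Prec.IH, presburger+)
  next
    case (Mu p) from Mu.prems show ?case by (cases q) (auto dest: Mu.IH, presburger+)
  qed
qed simp

definition phi :: "nat \<Rightarrow> nat \<Rightarrow> nat \<Rightarrow> bool" where
  "phi e x y \<longleftrightarrow> (\<exists>p. godel p = e \<and> evals p x y)"

definition W :: "nat \<Rightarrow> nat set" where
  "W e = {x. \<exists>y. phi e x y}"

definition computable :: "(nat \<Rightarrow> nat) \<Rightarrow> bool" where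
  "computable g \<longleftrightarrow> (\<exists>e. \<forall>i. phi e i (g i))"

text \<open>
  In \<open>uniformly idx a\<close>, the relation \<open>idx e b\<close> says that \<open>e\<close> is an index witnessing that the
  object \<open>b\<close> has the property in question.
\<close>

definition uniformly :: "(nat \<Rightarrow> 'b \<Rightarrow> bool) \<Rightarrow> (nat \<Rightarrow> 'b) \<Rightarrow> bool" where
  "uniformly idx a \<longleftrightarrow> (\<exists>g. computable g \<and> (\<forall>i. idx (g i) (a i)))"

definition rat_enum :: "nat \<Rightarrow> real" where
  "rat_enum j = (case prod_decode j of (a, b) \<Rightarrow> of_int (int_decode a) / of_nat (Suc b))"

definition posrat_enum :: "nat \<Rightarrow> real" where
  "posrat_enum j = (case prod_decode j of (a, b) \<Rightarrow> of_nat (Suc a) / of_nat (Suc b))"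

definition computable_real_index :: "nat \<Rightarrow> real \<Rightarrow> bool" where
  "computable_real_index e r \<longleftrightarrow> (\<forall>k. \<exists>j. phi e k j \<and> \<bar>rat_enum j - r\<bar> \<le> (1 / 2) ^ k)"

definition lower_semicomputable_index :: "nat \<Rightarrow> real \<Rightarrow> bool" where
  "lower_semicomputable_index e r \<longleftrightarrow> W e = {j. rat_enum j < r}"

definition computable_metric_space :: "(nat \<Rightarrow> 'a::polish_space) \<Rightarrow> bool" where
  "computable_metric_space s \<longleftrightarrow>
     closure (range s) = UNIV \<and>
     uniformly computable_real_index (\<lambda>k. case prod_decode k of (i, j) \<Rightarrow> dist (s i) (s j))"

definition ideal_ball :: "(nat \<Rightarrow> 'a::polish_space) \<Rightarrow> nat \<Rightarrow> 'a set" where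
  "ideal_ball s k = (case prod_decode k of (i, j) \<Rightarrow> {x. dist x (s i) < posrat_enum j})"

text \<open>
  \<open>Sigma0 s n e\<close> is the \<open>e\<close>-th \<open>\<Sigma>\<^sup>0\<^sub>n\<close> set.  The hierarchy starts at level 1; the value at
  level 0 is a dummy.
\<close>

fun Sigma0 :: "(nat \<Rightarrow> 'a::polish_space) \<Rightarrow> nat \<Rightarrow> nat \<Rightarrow> 'a set" where
  "Sigma0 s 0 e = {}"
| "Sigma0 s (Suc 0) e = (\<Union>i\<in>W e. ideal_ball s i)"
| "Sigma0 s (Suc (Suc n)) e = (\<Union>i\<in>W e. - Sigma0 s (Suc n) i)"

definition Sigma0_in_index ::
    "(nat \<Rightarrow> 'a::polish_space) \<Rightarrow> nat \<Rightarrow> 'a set \<Rightarrow> nat \<Rightarrow> 'a set \<Rightarrow> bool" where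
  "Sigma0_in_index s n D e A \<longleftrightarrow> A = D \<inter> Sigma0 s n e"

text \<open>Finite subsets of \<open>\<nat>\<close> are given by their canonical indices, via \<^const>\<open>set_decode\<close>.\<close>

definition computable_prob_space :: "(nat \<Rightarrow> 'a::polish_space) \<Rightarrow> 'a measure \<Rightarrow> bool" where
  "computable_prob_space s M \<longleftrightarrow>
     computable_metric_space s \<and> prob_space M \<and> sets M = sets borel \<and>
     uniformly lower_semicomputable_index
       (\<lambda>F. measure M (\<Union>i\<in>set_decode F. ideal_ball s i))"

definition pvimage :: "('a \<rightharpoonup> 'b) \<Rightarrow> 'b set \<Rightarrow> 'a set" where
  "pvimage g B = {x. \<exists>y\<in>B. g x = Some y}"

text \<open>
  A partial Borel map is a map on its domain that is measurable for the Borel sigma-algebra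
  of that subspace.  The domain itself is not required to be Borel, so preimages are measured
  by the completion of \<open>M\<close>; as \<^const>\<open>emeasure\<close> is 0 on non-measurable sets, the case
  \<open>B = UNIV\<close> forces the domain to be measurable there and of full measure.  If the
  domain is Borel, the preimages are Borel and the completion plays no role.
\<close>

definition measure_preserving :: "'a::polish_space measure \<Rightarrow> ('a \<rightharpoonup> 'a) \<Rightarrow> bool" where
  "measure_preserving M T \<longleftrightarrow>
     (\<lambda>x. the (T x)) \<in> restrict_space borel (dom T) \<rightarrow>\<^sub>M borel \<and>
     (\<forall>B\<in>sets borel. emeasure (completion M) (pvimage T B) = emeasure M B) \<and>
     (\<forall>x\<in>dom T. the (T x) \<in> dom T)"

definition computable_transformation :: "(nat \<Rightarrow> 'a::polish_space) \<Rightarrow> ('a \<rightharpoonup> 'a) \<Rightarrow> bool" where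
  "computable_transformation s T \<longleftrightarrow>
     uniformly (Sigma0_in_index s 1 (dom T)) (\<lambda>i. pvimage T (ideal_ball s i))"

definition computable_mps ::
    "(nat \<Rightarrow> 'a::polish_space) \<Rightarrow> 'a measure \<Rightarrow> ('a \<rightharpoonup> 'a) \<Rightarrow> bool" where
  "computable_mps s M T \<longleftrightarrow>
     computable_prob_space s M \<and> measure_preserving M T \<and> computable_transformation s T"

definition n_computable ::
    "(nat \<Rightarrow> 'a::polish_space) \<Rightarrow> nat \<Rightarrow> ('a \<rightharpoonup> ereal) \<Rightarrow> bool" where
  "n_computable s n f \<longleftrightarrow>
     uniformly (Sigma0_in_index s n (dom f)) (\<lambda>j. pvimage f {y. y > ereal (rat_enum j)}) \<and>
     uniformly (Sigma0_in_index s n (dom f)) (\<lambda>j. pvimage f {y. y < ereal (rat_enum j)})"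

text \<open>
  Integrability of an extended-real-valued function defined almost everywhere; the value 0
  off the domain is irrelevant, and the completion is used since the domain need not be Borel.
\<close>

definition pintegrable :: "'a measure \<Rightarrow> ('a \<rightharpoonup> ereal) \<Rightarrow> bool" where
  "pintegrable M f \<longleftrightarrow>
     (\<lambda>x. case f x of None \<Rightarrow> 0 | Some y \<Rightarrow> y) \<in> borel_measurable (completion M) \<and>
     (\<integral>\<^sup>+x. e2ennreal (case f x of None \<Rightarrow> 0 | Some y \<Rightarrow> \<bar>y\<bar>) \<partial>completion M) < \<infinity>"

definition n_test ::
    "(nat \<Rightarrow> 'a::polish_space) \<Rightarrow> 'a measure \<Rightarrow> nat \<Rightarrow> (nat \<Rightarrow> 'a set) \<Rightarrow> bool" where
  "n_test s M n U \<longleftrightarrow>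
     uniformly (\<lambda>e A. A = Sigma0 s n e) U \<and> (\<forall>k. measure M (U k) \<le> (1 / 2) ^ k)"

definition n_random :: "(nat \<Rightarrow> 'a::polish_space) \<Rightarrow> 'a measure \<Rightarrow> nat \<Rightarrow> 'a \<Rightarrow> bool" where
  "n_random s M n x \<longleftrightarrow> (\<forall>U. n_test s M n U \<longrightarrow> x \<notin> (\<Inter>k. U k))"

primrec piter :: "('a \<rightharpoonup> 'a) \<Rightarrow> nat \<Rightarrow> ('a \<rightharpoonup> 'a)" where
  "piter T 0 = Some"
| "piter T (Suc k) = T \<circ>\<^sub>m piter T k"

text \<open>
  Only meaningful if \<open>f (T\<^sup>k x)\<close> is defined for all \<open>k < N\<close>.  The library sets
  \<open>\<infinity> + (-\<infinity>) = \<infinity>\<close>, so once an infinite value occurs all later averages are infinite; an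
  average that is finite involves finite values only.
\<close>

definition ergodic_avg :: "('a \<rightharpoonup> 'a) \<Rightarrow> ('a \<rightharpoonup> ereal) \<Rightarrow> nat \<Rightarrow> 'a \<Rightarrow> ereal" where
  "ergodic_avg T f N x = ereal (1 / real N) * (\<Sum>k<N. the (f (the (piter T k x))))"

end

theory Submission
  imports Defs
begin

text \<open>
  The proof is effective in the manner of Bishop and V'yugin.  For rationals \<open>a < b\<close> the number of
  upcrossings of \<open>[a, b]\<close> by the averages \<open>A\<^sub>N f(x)\<close> has integral at most
  \<open>\<integral>(f - a)\<^sup>+ / (b - a)\<close>, by comparing the orbit of \<open>x\<close> with the orbit of \<open>T x\<close>.  The set of points with
  at least \<open>m\<close> upcrossings is \<open>\<Sigma>\<^sup>0\<^sub>n\<close> up to a null set, uniformly in \<open>m\<close>, so Markov's inequality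
  makes these sets a test and random points have finitely many upcrossings.  Taking \<open>a = 0\<close> and
  counting an initial rise above \<open>b\<close> as an upcrossing gives a maximal inequality, which for \<open>f\<close> and
  \<open>-f\<close> excludes infinite limits.  Effectivity rests on a universal machine: a c.e. union of
  \<open>\<Sigma>\<^sup>0\<^sub>n\<close> sets given by indices is \<open>\<Sigma>\<^sup>0\<^sub>n\<close>, uniformly.
\<close>

section \<open>Computable functions and an abstract machine for programs\<close>

text \<open>The obstacle is that \<open>n_computable\<close> supplies only strict rational bounds on
  the values of \<open>f\<close>, enumerable at level \<open>n\<close>, and only relative to the
  domain of \<open>f\<close>; likewise preimages under \<open>T\<close> are controlled only on
  \<open>dom T\<close>. Each test is therefore built on the whole space, from indices alone and
  without reference to the domains. Its sets mean the right thing wherever the whole orbit is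
  defined and \<open>f\<close> is finite along it. This holds almost everywhere, which yields the
  measure bounds, and it holds at the given random point, which yields the conclusions there. At
  that point finiteness is not a hypothesis, so infinite values along the orbit are excluded first,
  by tests that come from Markov's inequality for each iterate. Upcrossings suit this setting
  because each is a finite combination of strict inequalities between averages and rationals;
  nothing about the limit or the speed of convergence enters a test. The integrals in the bounds
  need not be computable: a natural number above them is hard-wired into the test.\<close>

definition pr :: "nat \<Rightarrow> nat \<Rightarrow> nat" where "pr x y = prod_encode (x, y)"
definition pfst :: "nat \<Rightarrow> nat" where "pfst z = fst (prod_decode z)"
definition psnd :: "nat \<Rightarrow> nat" where "psnd z = snd (prod_decode z)"

lemma pfst_pr [simp]: "pfst (pr x y) = x" and psnd_pr [simp]: "psnd (pr x y) = y"
  and pr_pfst_psnd [simp]: "pr (pfst z) (psnd z) = z"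
  by (auto simp: pr_def pfst_def psnd_def)

lemma pr_eq_iff [simp]: "pr x y = pr x' y' \<longleftrightarrow> x = x' \<and> y = y'"
  by (auto simp: pr_def)

lemma pr_cases: obtains x y where "z = pr x y"
  by (metis pr_pfst_psnd)

lemma prod_decode_pr: "prod_decode z = (pfst z, psnd z)"
  by (simp add: pfst_def psnd_def)

inductive_cases evals_ZeroE: "evals Zero x y"
  and evals_SuccE: "evals Succ x y"
  and evals_FstE: "evals Fst x y"
  and evals_SndE: "evals Snd x y"
  and evals_PairE: "evals (Pair p q) x y"
  and evals_CompE: "evals (Comp p q) x y"
  and evals_PrecE: "evals (Prec p q) x y"
  and evals_MuE: "evals (Mu p) x y"

lemma evals_Fst: "evals Fst z (pfst z)" and evals_Snd: "evals Snd z (psnd z)"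
  using evals.Fst[of "pfst z" "psnd z"] evals.Snd[of "pfst z" "psnd z"]
  by (simp_all flip: pr_def)

lemma evals_Pair: "evals p x y \<Longrightarrow> evals q x z \<Longrightarrow> evals (Pair p q) x (pr y z)"
  unfolding pr_def by (rule evals.Pair)

lemma evals_deterministic: "evals p x y \<Longrightarrow> evals p x z \<Longrightarrow> y = z"
proof (induction arbitrary: z rule: evals.induct)
  case (Mu p x m)
  from Mu.prems show ?case
  proof (rule evals_MuE)
    assume z: "evals p (prod_encode (x, z)) 0" "\<forall>i<z. \<exists>y. evals p (prod_encode (x, i)) (Suc y)"
    show "m = z"
    proof (rule linorder_cases[of m z])
      assume "m < z"
      then show ?thesis using z(2) Mu.IH(1) by fastforce
    next
      assume "z < m"
      then show ?thesis using Mu.IH(2) z(1) by fastforce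
    qed
  qed
next
  case (Prec_Suc p q x m y z)
  from Prec_Suc.prems show ?case
    by (rule evals_PrecE) (use Prec_Suc.IH in \<open>auto\<close>)
next
  case (Prec_0 p x y q)
  from Prec_0.prems show ?case
    by (rule evals_PrecE) (use Prec_0.IH in \<open>auto\<close>)
next
  case (Pair p x y q z)
  then show ?case by (metis evals_PairE)
next
  case (Comp q x y p z)
  then show ?case by (metis evals_CompE)
qed (auto elim: evals_ZeroE evals_SuccE evals_FstE evals_SndE)

lemma phi_deterministic: "phi e x y \<Longrightarrow> phi e x z \<Longrightarrow> y = z"
  unfolding phi_def by (metis evals_deterministic godel_inject)

lemma phi_godel [simp]: "phi (godel p) x y \<longleftrightarrow> evals p x y"
  by (auto simp: phi_def godel_inject)

lemma W_godel: "W (godel p) = {x. \<exists>y. evals p x y}"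
  by (simp add: W_def)

text \<open>The numbering has no gaps, so the machine never meets a number that is not the code of a
  program, and indices may be arbitrary numbers.\<close>

lemma godel_surj: "\<exists>p. godel p = e"
proof (induction e rule: less_induct)
  case (less e)
  show ?case
  proof (cases "e < 4")
    case True
    then have "e = 0 \<or> e = 1 \<or> e = 2 \<or> e = 3" by auto
    then show ?thesis by (metis godel.simps(1-4))
  next
    case False
    define k c where "k = (e - 4) div 4" and "c = (e - 4) mod 4"
    have e: "e = 4 * k + 4 + c" using False by (simp add: k_def c_def)
    have c: "c = 0 \<or> c = 1 \<or> c = 2 \<or> c = 3" unfolding c_def by linarith
    obtain a b where k: "k = prod_encode (a, b)" by (metis prod_decode_inverse prod.exhaust)
    have ab: "a \<le> k" "b \<le> k"
      unfolding k by (auto intro: le_prod_encode_1 le_prod_encode_2)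
    have "k < e" "a < e" "b < e" using e ab by auto
    with less.IH obtain p q r where pqr: "godel p = k" "godel q = a" "godel r = b" by meson
    from c show ?thesis
    proof (elim disjE)
      assume "c = 0" then show ?thesis using e k pqr by (intro exI[of _ "Pair q r"]) simp
    next
      assume "c = 1" then show ?thesis using e k pqr by (intro exI[of _ "Comp q r"]) simp
    next
      assume "c = 2" then show ?thesis using e k pqr by (intro exI[of _ "Prec q r"]) simp
    next
      assume "c = 3" then show ?thesis using e k pqr by (intro exI[of _ "Mu p"]) simp
    qed
  qed
qed

lemma computable_iff: "computable g \<longleftrightarrow> (\<exists>p. \<forall>i. evals p i (g i))"
  unfolding computable_def by (metis godel_surj phi_godel)

section \<open>Closure properties of computable functions and decidable predicates\<close>

named_theorems comp_intros

lemma computable_id [comp_intros]: "computable (\<lambda>x. x)"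
  unfolding computable_iff by (metis evals_Pair evals_Fst evals_Snd pr_pfst_psnd)

lemma computable_pfst0: "computable pfst" and computable_psnd0: "computable psnd"
  and computable_Suc0: "computable Suc"
  unfolding computable_iff by (metis evals_Fst evals_Snd evals.Succ)+

lemma computable_compose:
  assumes "computable f" "computable g" shows "computable (\<lambda>x. f (g x))"
  using assms unfolding computable_iff by (metis evals.Comp)

lemmas computable_pfst [comp_intros] = computable_compose[OF computable_pfst0]
lemmas computable_psnd [comp_intros] = computable_compose[OF computable_psnd0]
lemmas computable_Suc [comp_intros] = computable_compose[OF computable_Suc0]

lemma computable_pr [comp_intros]:
  assumes "computable f" "computable g" shows "computable (\<lambda>x. pr (f x) (g x))"
  using assms unfolding computable_iff by (metis evals_Pair)

lemma computable_const [comp_intros]: "computable (\<lambda>x. c)"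
proof (induction c)
  case 0 show ?case unfolding computable_iff by (metis evals.Zero)
next
  case (Suc c) then show ?case by (rule computable_Suc)
qed

lemma computable_rec:
  assumes "computable a" "computable (\<lambda>z. h (pfst z) (pfst (psnd z)) (psnd (psnd z)))" "computable b"
  shows "computable (\<lambda>x. rec_nat (a x) (h x) (b x))"
proof -
  obtain p where p: "\<And>i. evals p i (a i)" using assms(1) unfolding computable_iff by blast
  obtain q where q: "\<And>z. evals q z (h (pfst z) (pfst (psnd z)) (psnd (psnd z)))"
    using assms(2) unfolding computable_iff by blast
  have "evals (Prec p q) (pr x m) (rec_nat (a x) (h x) m)" for x m
  proof (induction m)
    case 0 show ?case using evals.Prec_0[OF p] by (simp add: pr_def)
  next
    case (Suc m)
    show ?case
      using evals.Prec_Suc[OF Suc[unfolded pr_def]] q[of "pr x (pr m (rec_nat (a x) (h x) m))"]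
      by (simp add: pr_def[symmetric])
  qed
  then have "computable (\<lambda>z. rec_nat (a (pfst z)) (h (pfst z)) (psnd z))"
    unfolding computable_iff by (metis pr_pfst_psnd)
  from computable_compose[OF this computable_pr[OF computable_id assms(3)]]
  show ?thesis by simp
qed

lemma computable_funpow:
  assumes "computable f" "computable a" "computable b"
  shows "computable (\<lambda>x. (f ^^ a x) (b x))"
proof -
  have "computable (\<lambda>x. rec_nat (b x) (\<lambda>_. f) (a x))"
    by (intro computable_rec assms computable_compose[OF assms(1)] comp_intros)
  moreover have "rec_nat y (\<lambda>_. f) m = (f ^^ m) y" for y m
    by (induction m) auto
  ultimately show ?thesis by simp
qed

lemma computable_add [comp_intros]:
  assumes "computable f" "computable g" shows "computable (\<lambda>x. f x + g x)"
proof -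
  have "computable (\<lambda>x. rec_nat (f x) (\<lambda>_ r. Suc r) (g x))"
    by (intro computable_rec assms comp_intros)
  moreover have "rec_nat y (\<lambda>_ r. Suc r) m = y + m" for y m by (induction m) auto
  ultimately show ?thesis by simp
qed

lemma computable_mult [comp_intros]:
  assumes "computable f" "computable g" shows "computable (\<lambda>x. f x * g x)"
proof -
  have "computable (\<lambda>x. rec_nat 0 (\<lambda>_ r. r + f x) (g x))"
    by (intro computable_rec assms comp_intros computable_compose[OF assms(1)])
  moreover have "rec_nat 0 (\<lambda>_ r. r + y) m = y * m" for y m :: nat by (induction m) auto
  ultimately show ?thesis by simp
qed

lemma computable_power [comp_intros]:
  assumes "computable f" "computable g" shows "computable (\<lambda>x. f x ^ g x)"
proof -
  have "computable (\<lambda>x. rec_nat 1 (\<lambda>_ r. r * f x) (g x))"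
    by (intro computable_rec assms comp_intros computable_compose[OF assms(1)])
  moreover have "rec_nat 1 (\<lambda>_ r. r * y) m = y ^ m" for y m :: nat by (induction m) auto
  ultimately show ?thesis by simp
qed

lemma computable_diff [comp_intros]:
  assumes "computable f" "computable g" shows "computable (\<lambda>x. f x - g x)"
proof -
  have *: "computable (\<lambda>x. f x - 1)" if "computable f" for f
  proof -
    have "computable (\<lambda>x. rec_nat 0 (\<lambda>m _. m) (f x))"
      by (intro computable_rec that comp_intros)
    moreover have "rec_nat 0 (\<lambda>m _. m) m = m - 1" for m :: nat by (cases m) auto
    ultimately show ?thesis by simp
  qed
  have "computable (\<lambda>x. rec_nat (f x) (\<lambda>_ r. r - 1) (g x))"
    by (intro computable_rec assms comp_intros *)
  moreover have "rec_nat y (\<lambda>_ r. r - 1) m = y - m" for y m :: nat by (induction m) auto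
  ultimately show ?thesis by simp
qed

definition decidable :: "(nat \<Rightarrow> bool) \<Rightarrow> bool" where
  "decidable P \<longleftrightarrow> computable (\<lambda>x. of_bool (P x))"

lemma computable_if [comp_intros]:
  assumes "decidable P" "computable f" "computable g"
  shows "computable (\<lambda>x. if P x then f x else g x)"
proof -
  have "computable (\<lambda>x. rec_nat (g x) (\<lambda>_ _. f x) (of_bool (P x)))"
    by (intro computable_rec assms comp_intros computable_compose[OF assms(2)])
      (use assms in \<open>auto simp: decidable_def\<close>)
  then show ?thesis by (rule back_subst[where P=computable]) auto
qed

lemma decidable_le [comp_intros]:
  assumes "computable f" "computable g" shows "decidable (\<lambda>x. f x \<le> g x)"
proof -
  have "computable (\<lambda>x. 1 - (f x - g x))" by (intro comp_intros assms)
  then show ?thesis unfolding decidable_def by (rule back_subst[where P=computable]) auto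
qed

lemma decidable_not [comp_intros]: "decidable P \<Longrightarrow> decidable (\<lambda>x. \<not> P x)"
proof -
  assume "decidable P"
  then have "computable (\<lambda>x. 1 - of_bool (P x))" by (intro comp_intros) (auto simp: decidable_def)
  then show ?thesis unfolding decidable_def by (rule back_subst[where P=computable]) auto
qed

lemma decidable_conj [comp_intros]: "decidable P \<Longrightarrow> decidable Q \<Longrightarrow> decidable (\<lambda>x. P x \<and> Q x)"
  unfolding decidable_def of_bool_conj by (intro comp_intros)

lemma decidable_less [comp_intros]:
  assumes "computable f" "computable g" shows "decidable (\<lambda>x. f x < g x)"
  using decidable_not[OF decidable_le[OF assms(2,1)]] by (simp add: not_le)

lemma decidable_eq [comp_intros]:
  assumes "computable f" "computable g" shows "decidable (\<lambda>x. f x = g x)"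
  using decidable_conj[OF decidable_le[OF assms] decidable_le[OF assms(2,1)]]
  by (simp add: order_eq_iff)

lemma computable_mod [comp_intros]:
  assumes "computable f" "0 < c" shows "computable (\<lambda>x. f x mod c)"
proof -
  have "computable (\<lambda>x. rec_nat 0 (\<lambda>_ r. if Suc r = c then 0 else Suc r) (f x))"
    by (intro computable_rec assms comp_intros)
  moreover have "rec_nat 0 (\<lambda>_ r. if Suc r = c then 0 else Suc r) m = m mod c" for m
    by (induction m) (auto simp: mod_Suc)
  ultimately show ?thesis by simp
qed

lemma computable_div [comp_intros]:
  assumes "computable f" "0 < c" shows "computable (\<lambda>x. f x div c)"
proof -
  have "computable (\<lambda>x. rec_nat 0 (\<lambda>m r. if Suc m mod c = 0 then Suc r else r) (f x))"
    by (intro computable_rec assms comp_intros)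
  moreover have "rec_nat 0 (\<lambda>m r. if Suc m mod c = 0 then Suc r else r) m = m div c" for m
    by (induction m) (auto simp: div_Suc)
  ultimately show ?thesis by simp
qed

section \<open>A stack machine that runs codes of programs\<close>

text \<open>
  Programs are run on a stack machine.  The state \<open>Ev e x K\<close> is about to run program \<open>e\<close> on \<open>x\<close>,
  and \<open>Ret y K\<close> passes the value \<open>y\<close> to the stack \<open>K\<close> of pending frames; \<open>Ret y 0\<close> is halted.  A frame
  has tag 0 or 4 (second component of \<open>Pair\<close> to be run, or to be combined), 1 (\<open>Comp\<close>), 2 (\<open>Prec\<close>)
  or 3 (\<open>Mu\<close>, with the current candidate).
\<close>

definition Ev :: "nat \<Rightarrow> nat \<Rightarrow> nat \<Rightarrow> nat" where "Ev e x K = pr 0 (pr (pr e x) K)"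
definition Ret :: "nat \<Rightarrow> nat \<Rightarrow> nat" where "Ret y K = pr 1 (pr y K)"
definition push :: "nat \<Rightarrow> nat \<Rightarrow> nat \<Rightarrow> nat" where "push t d K = Suc (pr (pr t d) K)"

definition ev_step :: "nat \<Rightarrow> nat \<Rightarrow> nat \<Rightarrow> nat" where
  "ev_step e x K =
    (if e = 0 then Ret 0 K
     else if e = 1 then Ret (Suc x) K
     else if e = 2 then Ret (pfst x) K
     else if e = 3 then Ret (psnd x) K
     else if e mod 4 = 0 then
       Ev (pfst ((e - 4) div 4)) x (push 0 (pr (psnd ((e - 4) div 4)) x) K)
     else if e mod 4 = 1 then
       Ev (psnd ((e - 4) div 4)) x (push 1 (pfst ((e - 4) div 4)) K)
     else if e mod 4 = 2 then
       (if psnd x = 0 then Ev (pfst ((e - 4) div 4)) (pfst x) K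
        else Ev e (pr (pfst x) (psnd x - 1))
          (push 2 (pr (psnd ((e - 4) div 4)) (pr (pfst x) (psnd x - 1))) K))
     else Ev ((e - 4) div 4) (pr x 0) (push 3 (pr ((e - 4) div 4) (pr x 0)) K))"

definition ret_step :: "nat \<Rightarrow> nat \<Rightarrow> nat \<Rightarrow> nat \<Rightarrow> nat" where
  "ret_step y t d K =
    (if t = 0 then Ev (pfst d) (psnd d) (push 4 y K)
     else if t = 1 then Ev d y K
     else if t = 2 then Ev (pfst d) (pr (pfst (psnd d)) (pr (psnd (psnd d)) y)) K
     else if t = 3 then
       (if y = 0 then Ret (psnd (psnd d)) K
        else Ev (pfst d) (pr (pfst (psnd d)) (Suc (psnd (psnd d))))
          (push 3 (pr (pfst d) (pr (pfst (psnd d)) (Suc (psnd (psnd d))))) K))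
     else Ret (pr d y) K)"

definition step :: "nat \<Rightarrow> nat" where
  "step S =
    (if pfst S = 0 then ev_step (pfst (pfst (psnd S))) (psnd (pfst (psnd S))) (psnd (psnd S))
     else if psnd (psnd S) = 0 then S
     else ret_step (pfst (psnd S)) (pfst (pfst (psnd (psnd S) - 1)))
       (psnd (pfst (psnd (psnd S) - 1))) (psnd (psnd (psnd S) - 1)))"

lemma computable_step0: "computable step"
  unfolding step_def ev_step_def ret_step_def Ev_def Ret_def push_def
  by (intro comp_intros) simp_all

lemma step_Ev: "step (Ev e x K) = ev_step e x K" by (simp add: step_def Ev_def)
lemma step_Ret_push: "step (Ret y (push t d K)) = ret_step y t d K"
  by (simp add: step_def Ret_def push_def)

text \<open>Tags above 1 do not arise in a run, but \<open>step\<close> treats every nonzero tag as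
  a return, so the soundness proof has to cover such states too.\<close>

lemma state_cases:
  obtains p x K where "S = Ev (godel p) x K" | m y where "S = pr (Suc m) (pr y 0)"
    | m y t d K where "S = pr (Suc m) (pr y (push t d K))"
proof (cases "pfst S")
  case 0
  then have "S = Ev (pfst (pfst (psnd S))) (psnd (pfst (psnd S))) (psnd (psnd S))"
    unfolding Ev_def by (metis pr_pfst_psnd)
  then show ?thesis using that(1) by (metis godel_surj)
next
  case (Suc m)
  show ?thesis
  proof (cases "psnd (psnd S)")
    case 0 then show ?thesis using that(2) Suc by (metis pr_pfst_psnd)
  next
    case (Suc K)
    then have "psnd (psnd S) = push (pfst (pfst K)) (psnd (pfst K)) (psnd K)"
      by (simp add: push_def)
    then show ?thesis using that(3) \<open>pfst S = Suc m\<close> by (metis pr_pfst_psnd)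
  qed
qed

lemma ev_step_godel:
  "ev_step (godel Zero) x K = Ret 0 K"
  "ev_step (godel Succ) x K = Ret (Suc x) K"
  "ev_step (godel Fst) x K = Ret (pfst x) K"
  "ev_step (godel Snd) x K = Ret (psnd x) K"
  "ev_step (godel (Pair p q)) x K = Ev (godel p) x (push 0 (pr (godel q) x) K)"
  "ev_step (godel (Comp p q)) x K = Ev (godel q) x (push 1 (godel p) K)"
  "ev_step (godel (Prec p q)) x K =
    (if psnd x = 0 then Ev (godel p) (pfst x) K
     else Ev (godel (Prec p q)) (pr (pfst x) (psnd x - 1))
       (push 2 (pr (godel q) (pr (pfst x) (psnd x - 1))) K))"
  "ev_step (godel (Mu p)) x K = Ev (godel p) (pr x 0) (push 3 (pr (godel p) (pr x 0)) K)"
proof -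
  have m: "(4 * k + 5) mod 4 = 1" "(4 * k + 6) mod 4 = 2" "(4 * k + 7) mod 4 = 3"
    "Suc (4 * k) div 4 = k" "(4 * k + 2) div 4 = k" "(4 * k + 3) div 4 = k"
    "Suc (Suc (4 * k)) div 4 = k" for k :: nat
    by presburger+
  show "ev_step (godel Zero) x K = Ret 0 K"
  "ev_step (godel Succ) x K = Ret (Suc x) K"
  "ev_step (godel Fst) x K = Ret (pfst x) K"
  "ev_step (godel Snd) x K = Ret (psnd x) K"
    by (simp_all add: ev_step_def)
  show
  "ev_step (godel (Pair p q)) x K = Ev (godel p) x (push 0 (pr (godel q) x) K)"
  "ev_step (godel (Comp p q)) x K = Ev (godel q) x (push 1 (godel p) K)"
  "ev_step (godel (Prec p q)) x K =
    (if psnd x = 0 then Ev (godel p) (pfst x) K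
     else Ev (godel (Prec p q)) (pr (pfst x) (psnd x - 1))
       (push 2 (pr (godel q) (pr (pfst x) (psnd x - 1))) K))"
  "ev_step (godel (Mu p)) x K = Ev (godel p) (pr x 0) (push 3 (pr (godel p) (pr x 0)) K)"
    by (simp_all add: ev_step_def m flip: pr_def)
qed

definition reach :: "nat \<Rightarrow> nat \<Rightarrow> bool" where
  "reach S S' \<longleftrightarrow> (\<exists>t. (step ^^ t) S = S')"

lemma reach_refl: "reach S S"
  unfolding reach_def by (metis funpow_0)

lemma reach_trans [trans]: "reach S S' \<Longrightarrow> reach S' S'' \<Longrightarrow> reach S S''"
  unfolding reach_def by (metis comp_apply funpow_add)

lemma reach_step: "reach (step S) S' \<Longrightarrow> reach S S'"
  unfolding reach_def by (metis comp_apply funpow_Suc_right)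

text \<open>The stack \<open>K\<close> stays arbitrary in the induction because subprograms run with
  further frames on top of it.\<close>

lemma evals_reach: "evals p x y \<Longrightarrow> reach (Ev (godel p) x K) (Ret y K)"
proof (induction arbitrary: K rule: evals.induct)
  case (Zero x)
  show ?case by (rule reach_step) (simp only: step_Ev ev_step_godel reach_refl)
next
  case (Succ x)
  show ?case by (rule reach_step) (simp only: step_Ev ev_step_godel reach_refl)
next
  case (Fst x y)
  show ?case
    by (rule reach_step) (simp only: step_Ev ev_step_godel reach_refl pfst_pr flip: pr_def)
next
  case (Snd x y)
  show ?case
    by (rule reach_step) (simp only: step_Ev ev_step_godel reach_refl psnd_pr flip: pr_def)
next
  case (Pair p x y q z)
  have "reach (step (Ret y (push 0 (pr (godel q) x) K))) (Ret z (push 4 y K))"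
    unfolding step_Ret_push ret_step_def using Pair.IH(2) by simp
  also have "reach \<dots> (Ret (pr y z) K)"
    by (rule reach_step) (simp add: step_Ret_push ret_step_def reach_refl)
  finally have "reach (Ret y (push 0 (pr (godel q) x) K)) (Ret (pr y z) K)"
    by (rule reach_step)
  with Pair.IH(1) have "reach (step (Ev (godel (prog.Pair p q)) x K)) (Ret (pr y z) K)"
    unfolding step_Ev ev_step_godel by (rule reach_trans)
  then show ?case unfolding pr_def by (rule reach_step)
next
  case (Comp q x y p z)
  have "reach (step (Ret y (push 1 (godel p) K))) (Ret z K)"
    unfolding step_Ret_push ret_step_def using Comp.IH(2) by simp
  then have "reach (Ret y (push 1 (godel p) K)) (Ret z K)"
    by (rule reach_step)
  with Comp.IH(1) have "reach (step (Ev (godel (prog.Comp p q)) x K)) (Ret z K)"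
    unfolding step_Ev ev_step_godel by (rule reach_trans)
  then show ?case by (rule reach_step)
next
  case (Prec_0 p x y q)
  show ?case
    by (rule reach_step) (use Prec_0.IH in \<open>simp add: step_Ev ev_step_godel del: godel.simps flip: pr_def\<close>)
next
  case (Prec_Suc p q x m y z)
  have "reach (step (Ret y (push 2 (pr (godel q) (pr x m)) K))) (Ret z K)"
    unfolding step_Ret_push ret_step_def using Prec_Suc.IH(2) by (simp flip: pr_def)
  then have "reach (Ret y (push 2 (pr (godel q) (pr x m)) K)) (Ret z K)"
    by (rule reach_step)
  with Prec_Suc.IH(1) have "reach (step (Ev (godel (Prec p q)) (pr x (Suc m)) K)) (Ret z K)"
    unfolding step_Ev ev_step_godel pr_def[symmetric] by (simp del: godel.simps) (rule reach_trans)
  then show ?case unfolding pr_def by (rule reach_step)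
next
  case (Mu p x m)
  \<comment> \<open>Downward induction on the candidate: at \<open>m\<close> the value 0 ends the
    search, and below \<open>m\<close> a nonzero value hands over to the next candidate.\<close>
  have "reach (Ev (godel p) (pr x i) (push 3 (pr (godel p) (pr x i)) K)) (Ret m K)" if "i \<le> m" for i
    using that
  proof (induction rule: inc_induct)
    case base
    have "reach (Ret 0 (push 3 (pr (godel p) (pr x m)) K)) (Ret m K)"
      by (rule reach_step) (simp add: step_Ret_push ret_step_def reach_refl)
    with Mu.IH(1) show ?case unfolding pr_def[symmetric] by (rule reach_trans)
  next
    case (step i)
    then obtain y where "reach (Ev (godel p) (pr x i) (push 3 (pr (godel p) (pr x i)) K))
        (Ret (Suc y) (push 3 (pr (godel p) (pr x i)) K))"
      using Mu.IH(2) unfolding pr_def by blast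
    also have "reach \<dots> (Ret m K)"
      by (rule reach_step) (use step.IH in \<open>simp add: step_Ret_push ret_step_def\<close>)
    finally show ?case .
  qed
  then have "reach (step (Ev (godel (prog.Mu p)) x K)) (Ret m K)"
    by (simp add: step_Ev ev_step_godel del: godel.simps)
  then show ?case by (rule reach_step)
qed

section \<open>Soundness of the machine\<close>

text \<open>
  \<open>cont v K y\<close>: feeding \<open>v\<close> to the stack \<open>K\<close> yields \<open>y\<close> in the sense of \<^const>\<open>evals\<close>.  This meaning of
  a state is preserved by steps backwards, which gives soundness of the machine.
\<close>

inductive cont :: "nat \<Rightarrow> nat \<Rightarrow> nat \<Rightarrow> bool" where
  cont_0: "cont v 0 v"
| cont_pair1: "phi (pfst d) (psnd d) w \<Longrightarrow> cont (pr v w) K y \<Longrightarrow> cont v (push 0 d K) y"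
| cont_comp: "phi d v w \<Longrightarrow> cont w K y \<Longrightarrow> cont v (push 1 d K) y"
| cont_prec: "phi (pfst d) (pr (pfst (psnd d)) (pr (psnd (psnd d)) v)) w \<Longrightarrow> cont w K y \<Longrightarrow>
    cont v (push 2 d K) y"
| cont_mu_0: "cont (psnd (psnd d)) K y \<Longrightarrow> cont 0 (push 3 d K) y"
| cont_mu_Suc: "psnd (psnd d) < m \<Longrightarrow> phi (pfst d) (pr (pfst (psnd d)) m) 0 \<Longrightarrow>
    (\<forall>i. psnd (psnd d) < i \<longrightarrow> i < m \<longrightarrow> (\<exists>u. phi (pfst d) (pr (pfst (psnd d)) i) (Suc u))) \<Longrightarrow>
    cont m K y \<Longrightarrow> cont (Suc v) (push 3 d K) y"
| cont_pair2: "4 \<le> t \<Longrightarrow> cont (pr d v) K y \<Longrightarrow> cont v (push t d K) y"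

lemma push_eq_iff [simp]: "push t d K = push t' d' K' \<longleftrightarrow> t = t' \<and> d = d' \<and> K = K'"
  and push_neq_0 [simp]: "push t d K \<noteq> 0" "0 \<noteq> push t d K"
  by (auto simp: push_def)

inductive_cases cont_0E: "cont v 0 y"
  and cont_push0E: "cont v (push 0 d K) y"
  and cont_push1E: "cont v (push (Suc 0) d K) y"
  and cont_push2E: "cont v (push 2 d K) y"
  and cont_push3E: "cont v (push 3 d K) y"
  and cont_push4E: "cont v (push 4 d K) y"

definition sem :: "nat \<Rightarrow> nat \<Rightarrow> bool" where
  "sem S y \<longleftrightarrow> (if pfst S = 0
     then \<exists>v. phi (pfst (pfst (psnd S))) (psnd (pfst (psnd S))) v \<and> cont v (psnd (psnd S)) y
     else cont (pfst (psnd S)) (psnd (psnd S)) y)"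

lemma sem_Ev: "sem (Ev e x K) y \<longleftrightarrow> (\<exists>v. phi e x v \<and> cont v K y)"
  and sem_Ret: "sem (Ret v K) y \<longleftrightarrow> cont v K y"
  by (simp_all add: sem_def Ev_def Ret_def)

lemma sem_ev_step:
  assumes "sem (ev_step (godel p) x K) y"
  shows "\<exists>v. evals p x v \<and> cont v K y"
proof (cases p)
  case Zero
  then show ?thesis using assms unfolding Zero ev_step_godel sem_Ret by (blast intro: evals.Zero)
next
  case Succ
  then show ?thesis using assms unfolding Succ ev_step_godel sem_Ret by (blast intro: evals.Succ)
next
  case Fst
  then show ?thesis using assms unfolding Fst ev_step_godel sem_Ret by (blast intro: evals_Fst)
next
  case Snd
  then show ?thesis using assms unfolding Snd ev_step_godel sem_Ret by (blast intro: evals_Snd)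
next
  case (Pair p q)
  show ?thesis using assms unfolding Pair ev_step_godel sem_Ev phi_godel
    by (auto elim!: cont_push0E dest: evals_Pair)
next
  case (Comp p q)
  show ?thesis using assms unfolding Comp ev_step_godel sem_Ev phi_godel
    by (auto elim!: cont_push1E dest: evals.Comp)
next
  case (Prec p q)
  obtain a b where x: "x = pr a b" by (rule pr_cases)
  show ?thesis
  proof (cases b)
    case 0
    from assms obtain v where "evals p a v" "cont v K y"
      unfolding Prec ev_step_godel x 0 by (auto simp: sem_Ev simp del: godel.simps)
    then show ?thesis unfolding Prec x 0 pr_def by (blast intro: evals.Prec_0)
  next
    case (Suc m)
    from assms obtain v w where "evals (Prec p q) (pr a m) v" "evals q (pr a (pr m v)) w" "cont w K y"
      unfolding Prec ev_step_godel x Suc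
      by (auto simp: sem_Ev simp del: godel.simps elim!: cont_push2E)
    then show ?thesis unfolding Prec x Suc pr_def by (blast intro: evals.Prec_Suc)
  qed
next
  case (Mu p)
  from assms obtain v where v: "evals p (pr x 0) v" "cont v (push 3 (pr (godel p) (pr x 0)) K) y"
    unfolding Mu ev_step_godel sem_Ev by auto
  from v(2) show ?thesis
  proof (rule cont_push3E)
    assume "v = 0" "cont (psnd (psnd (pr (godel p) (pr x 0)))) K y"
    moreover from this have "evals (prog.Mu p) x 0"
      using v(1) by (intro evals.Mu) (auto simp: pr_def)
    ultimately show ?thesis unfolding Mu by auto
  next
    fix m w
    assume *: "v = Suc w" "psnd (psnd (pr (godel p) (pr x 0))) < m"
      "phi (pfst (pr (godel p) (pr x 0))) (pr (pfst (psnd (pr (godel p) (pr x 0)))) m) 0"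
      "\<forall>i. psnd (psnd (pr (godel p) (pr x 0))) < i \<longrightarrow> i < m \<longrightarrow>
         (\<exists>u. phi (pfst (pr (godel p) (pr x 0))) (pr (pfst (psnd (pr (godel p) (pr x 0)))) i) (Suc u))"
      "cont m K y"
    have "\<exists>u. evals p (pr x i) (Suc u)" if "i < m" for i
      using * that v(1) by (cases "i = 0") auto
    then have "evals (prog.Mu p) x m"
      using * by (intro evals.Mu[folded pr_def]) auto
    then show ?thesis using *(5) unfolding Mu by blast
  qed
qed

lemma sem_step: "sem (step S) y \<Longrightarrow> sem S y"
proof (cases S rule: state_cases)
  case (1 p x K)
  assume "sem (step S) y"
  then show ?thesis unfolding 1 step_Ev sem_Ev phi_godel by (rule sem_ev_step)
next
  case (2 m v)
  assume "sem (step S) y"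
  then show ?thesis by (simp add: step_def 2)
next
  case (3 m v t d K)
  assume "sem (step S) y"
  then have *: "sem (ret_step v t d K) y"
    by (simp add: step_def 3 push_def)
  have "cont v (push t d K) y"
  proof -
    consider "t = 0" | "t = 1" | "t = 2" | "t = 3" "v = 0" | w where "t = 3" "v = Suc w" | "4 \<le> t"
      by (cases v) force+
    then show ?thesis
    proof cases
      case 1
      with * show ?thesis
        by (auto simp: ret_step_def sem_Ev elim!: cont_push4E intro: cont.intros)
    next
      case 2
      with * show ?thesis
        by (auto simp: ret_step_def sem_Ev intro: cont.intros[simplified])
    next
      case 3
      with * show ?thesis
        by (auto simp: ret_step_def sem_Ev intro: cont.intros)
    next
      case 4
      with * show ?thesis
        by (auto simp: ret_step_def sem_Ret intro: cont.intros)
    next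
      case (5 w)
      let ?e = "pfst d" and ?x = "pfst (psnd d)" and ?m = "psnd (psnd d)"
      from 5 * obtain u where u: "phi ?e (pr ?x (Suc ?m)) u"
        "cont u (push 3 (pr ?e (pr ?x (Suc ?m))) K) y"
        by (auto simp: ret_step_def sem_Ev)
      \<comment> \<open>The candidate \<open>?m\<close> has failed. Either \<open>Suc ?m\<close>
        succeeds or the search continued from there stops later; \<open>cont_mu_Suc\<close> covers
        both.\<close>
      from u(2) show ?thesis unfolding 5
      proof (rule cont_push3E)
        assume "u = 0" "cont (psnd (psnd (pr ?e (pr ?x (Suc ?m))))) K y"
        then show "cont (Suc w) (push 3 d K) y"
          using u(1) by (intro cont_mu_Suc[of _ "Suc ?m"]) auto
      next
        fix m' u'
        assume a: "u = Suc u'" "psnd (psnd (pr ?e (pr ?x (Suc ?m)))) < m'"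
         "phi (pfst (pr ?e (pr ?x (Suc ?m)))) (pr (pfst (psnd (pr ?e (pr ?x (Suc ?m))))) m') 0"
         "\<forall>i. psnd (psnd (pr ?e (pr ?x (Suc ?m)))) < i \<longrightarrow> i < m' \<longrightarrow>
            (\<exists>u. phi (pfst (pr ?e (pr ?x (Suc ?m)))) (pr (pfst (psnd (pr ?e (pr ?x (Suc ?m))))) i) (Suc u))"
         "cont m' K y"
        show "cont (Suc w) (push 3 d K) y"
        proof (rule cont_mu_Suc[of _ m'])
          show "\<forall>i. ?m < i \<longrightarrow> i < m' \<longrightarrow> (\<exists>u. phi ?e (pr ?x i) (Suc u))"
            using a(1,4) u(1) by (metis Suc_lessI pfst_pr psnd_pr)
        qed (use a in auto)
      qed
    next
      case 6
      with * show ?thesis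
        by (auto simp: ret_step_def sem_Ret intro: cont.intros)
    qed
  qed
  then show ?thesis by (simp add: sem_def 3)
qed

text \<open>This serves as the universal machine: for each step count \<open>t\<close> the
  right-hand side is a decidable condition on numbers in which the program is a variable, so
  membership in \<open>W\<close> is c.e. jointly in element and index.\<close>

theorem phi_iff_step: "phi e x y \<longleftrightarrow> (\<exists>t. (step ^^ t) (Ev e x 0) = Ret y 0)"
proof
  assume "phi e x y"
  then show "\<exists>t. (step ^^ t) (Ev e x 0) = Ret y 0"
    unfolding phi_def using evals_reach reach_def by auto
next
  assume "\<exists>t. (step ^^ t) (Ev e x 0) = Ret y 0"
  then obtain t where t: "(step ^^ t) (Ev e x 0) = Ret y 0" ..
  have "sem S y" if "(step ^^ t) S = Ret y 0" for S
    using that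
  proof (induction t arbitrary: S)
    case 0 then show ?case by (simp add: sem_Ret cont_0)
  next
    case (Suc t) then show ?case by (metis sem_step comp_apply funpow_Suc_right)
  qed
  from this[OF t] show "phi e x y" by (auto simp: sem_Ev elim: cont_0E)
qed

section \<open>Computably enumerable predicates\<close>

definition ce :: "(nat \<Rightarrow> bool) \<Rightarrow> bool" where
  "ce P \<longleftrightarrow> (\<exists>e. W e = {x. P x})"

definition halted :: "nat \<Rightarrow> nat \<Rightarrow> nat \<Rightarrow> bool" where
  "halted e x t \<longleftrightarrow> (\<exists>y. (step ^^ t) (Ev e x 0) = Ret y 0)"

lemma W_iff_halted: "x \<in> W e \<longleftrightarrow> (\<exists>t. halted e x t)"
  by (auto simp: W_def halted_def phi_iff_step)

lemma decidable_phi_step: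
  assumes "computable e" "computable x" "computable t" "computable y"
  shows "decidable (\<lambda>z. (step ^^ t z) (Ev (e z) (x z) 0) = Ret (y z) 0)"
  unfolding Ev_def Ret_def
  by (intro comp_intros computable_funpow computable_step0 assms)

lemma decidable_halted:
  assumes "computable e" "computable x" "computable t"
  shows "decidable (\<lambda>z. halted (e z) (x z) (t z))"
proof -
  have "(\<exists>y. S = Ret y 0) \<longleftrightarrow> pfst S = 1 \<and> psnd (psnd S) = 0" for S
  proof
    assume S: "pfst S = 1 \<and> psnd (psnd S) = 0"
    show "\<exists>y. S = Ret y 0"
      by (intro exI[of _ "pfst (psnd S)"]) (metis S Ret_def pr_pfst_psnd)
  qed (auto simp: Ret_def)
  then show ?thesis
    unfolding halted_def Ev_def
    by (simp only:) (intro comp_intros computable_funpow computable_step0 assms)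
qed

lemma decidable_imp_ce_ex:
  assumes "decidable (\<lambda>z. R (pfst z) (psnd z))"
  shows "ce (\<lambda>x. \<exists>t. R x t)"
proof -
  \<comment> \<open>\<open>Mu\<close> searches for the value 0, hence the truth value of the
    negation.\<close>
  have "computable (\<lambda>z. of_bool (\<not> R (pfst z) (psnd z)))"
    using decidable_not[OF assms] by (simp add: decidable_def)
  then obtain p where "\<And>z. evals p z (of_bool (\<not> R (pfst z) (psnd z)))"
    unfolding computable_iff by blast
  from this[of "pr _ _"] have p: "evals p (prod_encode (x, t)) (of_bool (\<not> R x t))" for x t
    by (simp add: pr_def[symmetric])
  have "(\<exists>m. evals (Mu p) x m) \<longleftrightarrow> (\<exists>t. R x t)" for x
  proof
    assume "\<exists>m. evals (Mu p) x m"
    then obtain m where "evals p (prod_encode (x, m)) 0" by (auto elim: evals_MuE)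
    with p have "of_bool (\<not> R x m) = (0::nat)" using evals_deterministic by blast
    then show "\<exists>t. R x t" by auto
  next
    assume ex: "\<exists>t. R x t"
    define m where "m = (LEAST t. R x t)"
    have "R x m" unfolding m_def using ex by (rule LeastI_ex)
    moreover have "\<not> R x i" if "i < m" for i
      using that not_less_Least unfolding m_def by blast
    ultimately have "evals p (prod_encode (x, m)) 0" "\<forall>i<m. evals p (prod_encode (x, i)) (Suc 0)"
      using p[of x] by (metis of_bool_eq(1), metis of_bool_eq(2) One_nat_def)
    then have "evals (Mu p) x m" by (blast intro: evals.Mu)
    then show "\<exists>m. evals (Mu p) x m" ..
  qed
  then have "W (godel (Mu p)) = {x. \<exists>t. R x t}" unfolding W_godel by simp
  then show ?thesis unfolding ce_def ..
qed

lemma ce_iff: "ce P \<longleftrightarrow> (\<exists>R. decidable (\<lambda>z. R (pfst z) (psnd z)) \<and> P = (\<lambda>x. \<exists>t. R x t))"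
proof
  assume "ce P"
  then obtain e where e: "W e = {x. P x}" by (auto simp: ce_def)
  show "\<exists>R. decidable (\<lambda>z. R (pfst z) (psnd z)) \<and> P = (\<lambda>x. \<exists>t. R x t)"
  proof (intro exI[of _ "halted e"] conjI ext)
    show "P x = (\<exists>t. halted e x t)" for x
      using e W_iff_halted by auto
  qed (intro decidable_halted comp_intros)
qed (auto intro: decidable_imp_ce_ex)

lemma decidable_compose: "decidable P \<Longrightarrow> computable f \<Longrightarrow> decidable (\<lambda>x. P (f x))"
  unfolding decidable_def by (rule computable_compose)

lemma decidable_disj [comp_intros]: "decidable P \<Longrightarrow> decidable Q \<Longrightarrow> decidable (\<lambda>x. P x \<or> Q x)"
  using decidable_not[OF decidable_conj[OF decidable_not decidable_not]] by simp

named_theorems ce_intros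

lemma ce_ex [ce_intros]: assumes "ce (\<lambda>z. P (pfst z) (psnd z))" shows "ce (\<lambda>x. \<exists>y. P x y)"
proof -
  obtain R where R: "decidable (\<lambda>z. R (pfst z) (psnd z))"
    and P: "(\<lambda>z. P (pfst z) (psnd z)) = (\<lambda>x. \<exists>t. R x t)"
    using assms unfolding ce_iff by blast
  have "ce (\<lambda>x. \<exists>t. R (pr x (pfst t)) (psnd t))"
    by (rule decidable_imp_ce_ex,
        rule decidable_compose[OF R, of "\<lambda>z. pr (pr (pfst z) (pfst (psnd z))) (psnd (psnd z))", simplified])
      (intro comp_intros)
  moreover have "(\<exists>y. P x y) \<longleftrightarrow> (\<exists>t. R (pr x (pfst t)) (psnd t))" for x
  proof -
    have "P x y \<longleftrightarrow> (\<exists>t. R (pr x y) t)" for y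
      using fun_cong[OF P, of "pr x y"] by simp
    then show ?thesis by (metis pfst_pr psnd_pr)
  qed
  ultimately show ?thesis by simp
qed

lemma decidable_imp_ce: assumes "decidable P" shows "ce P"
  using decidable_imp_ce_ex[of "\<lambda>x _. P x"] decidable_compose[OF assms computable_pfst0] by simp

lemma ce_conj [ce_intros]: assumes "ce P" "ce Q" shows "ce (\<lambda>x. P x \<and> Q x)"
proof -
  obtain R where R: "decidable (\<lambda>z. R (pfst z) (psnd z))" "P = (\<lambda>x. \<exists>t. R x t)"
    using assms(1) unfolding ce_iff by blast
  obtain S where S: "decidable (\<lambda>z. S (pfst z) (psnd z))" "Q = (\<lambda>x. \<exists>t. S x t)"
    using assms(2) unfolding ce_iff by blast
  have "ce (\<lambda>x. \<exists>t u. R x t \<and> S x u)"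
  proof (rule ce_ex, rule decidable_imp_ce_ex, rule decidable_conj)
    show "decidable (\<lambda>z. R (pfst (pfst z)) (psnd (pfst z)))"
      by (rule decidable_compose[OF R(1) computable_pfst0])
    have c: "computable (\<lambda>z. pr (pfst (pfst z)) (psnd z))" by (intro comp_intros)
    show "decidable (\<lambda>z. S (pfst (pfst z)) (psnd z))"
      using decidable_compose[OF S(1) c] by simp
  qed
  then show ?thesis unfolding R S by simp
qed

lemma ce_disj [ce_intros]: assumes "ce P" "ce Q" shows "ce (\<lambda>x. P x \<or> Q x)"
proof -
  obtain R where R: "decidable (\<lambda>z. R (pfst z) (psnd z))" "P = (\<lambda>x. \<exists>t. R x t)"
    using assms(1) unfolding ce_iff by blast
  obtain S where S: "decidable (\<lambda>z. S (pfst z) (psnd z))" "Q = (\<lambda>x. \<exists>t. S x t)"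
    using assms(2) unfolding ce_iff by blast
  have "ce (\<lambda>x. \<exists>t. R x t \<or> S x t)"
    by (intro decidable_imp_ce_ex decidable_disj R(1) S(1))
  then show ?thesis unfolding R S by (simp add: ex_disj_distrib)
qed

lemma ce_W [ce_intros]: assumes "computable f" "computable g" shows "ce (\<lambda>z. f z \<in> W (g z))"
  unfolding W_iff_halted
  by (intro decidable_imp_ce_ex decidable_halted comp_intros
      computable_compose[OF assms(1)] computable_compose[OF assms(2)])

lemma ce_phi [ce_intros]:
  assumes "computable f" "computable g" "computable h" shows "ce (\<lambda>z. phi (f z) (g z) (h z))"
  unfolding phi_iff_step
  by (intro decidable_imp_ce_ex decidable_phi_step comp_intros
      computable_compose[OF assms(1)] computable_compose[OF assms(2)] computable_compose[OF assms(3)])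

lemma ce_compose: assumes "ce P" "computable f" shows "ce (\<lambda>x. P (f x))"
proof -
  obtain e where "W e = {x. P x}" using assms(1) by (auto simp: ce_def)
  then have "(\<lambda>x. P (f x)) = (\<lambda>x. f x \<in> W e)" by auto
  then show ?thesis by (simp only:) (intro ce_W assms comp_intros)
qed

text \<open>The program for \<open>i\<close> pairs its input with the hard-wired constant
  \<open>i\<close> before running the given one; its code is computable from \<open>i\<close>
  because \<open>godel\<close> is explicit.\<close>

lemma smn:
  assumes "ce P"
  shows "\<exists>g. computable g \<and> (\<forall>i. W (g i) = {x. P (pr i x)})"
proof -
  obtain e where e: "W e = {x. P x}" using assms by (auto simp: ce_def)
  obtain p where p: "godel p = e" using godel_surj by blast
  \<comment> \<open>\<open>c i\<close> iterates the effect of \<open>Comp Succ\<close> on codes: 1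
    is the code of \<open>Succ\<close>, and 0 that of \<open>Zero\<close>.\<close>
  define c where "c i = ((\<lambda>m. 4 * pr 1 m + 5) ^^ i) 0" for i
  have c: "computable c"
    unfolding c_def by (intro computable_funpow comp_intros)
  define const where "const i = (Comp Succ ^^ i) Zero" for i
  have "godel (const i) = c i" for i
    by (induction i) (simp_all add: const_def c_def pr_def)
  have const: "evals (const i) x i" for i x
    by (induction i) (auto simp: const_def intro: evals.intros)
  \<comment> \<open>\<open>Pair Fst Snd\<close> is a program for the identity.\<close>
  define q where "q i = Comp p (Pair (const i) (Pair Fst Snd))" for i
  have "godel (q i) = 4 * pr e (4 * pr (c i) (godel (Pair Fst Snd)) + 4) + 5" for i
    by (simp add: q_def p pr_def \<open>godel (const i) = c i\<close>)
  then have "computable (\<lambda>i. godel (q i))"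
    by (simp only:) (intro comp_intros computable_compose[OF c])
  moreover have "W (godel (q i)) = {x. P (pr i x)}" for i
  proof -
    have "evals (Pair Fst Snd) x x" for x
      using evals_Pair[OF evals_Fst evals_Snd, of x] by simp
    then have *: "evals (Pair (const i) (Pair Fst Snd)) x (pr i x)" for x
      by (intro evals_Pair const)
    have "(\<exists>y. evals (q i) x y) \<longleftrightarrow> (\<exists>y. evals p (pr i x) y)" for x
      unfolding q_def using * by (metis evals.Comp evals_CompE evals_deterministic)
    then show ?thesis
      using e unfolding W_godel p[symmetric] by auto
  qed
  ultimately show ?thesis by (intro exI[of _ "\<lambda>i. godel (q i)"]) auto
qed

section \<open>Decidable comparison of rationals\<close>

text \<open>Rationals are compared after clearing denominators; the numerator \<open>int_decode a\<close> is
  a difference of two natural numbers.\<close>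

definition rpos :: "nat \<Rightarrow> nat" where
  "rpos j = (if pfst j mod 2 = 0 then pfst j div 2 else 0)"
definition rneg :: "nat \<Rightarrow> nat" where
  "rneg j = (if pfst j mod 2 = 0 then 0 else Suc (pfst j div 2))"

lemma rat_enum_eq: "rat_enum j = (real (rpos j) - real (rneg j)) / real (Suc (psnd j))"
  by (auto simp: rat_enum_def prod_decode_pr rpos_def rneg_def int_decode_def sum_decode_def
      even_iff_mod_2_eq_zero field_simps)

lemma computable_rpos0: "computable rpos" and computable_rneg0: "computable rneg"
  unfolding rpos_def rneg_def by (intro comp_intros; simp)+

lemmas computable_rpos [comp_intros] = computable_compose[OF computable_rpos0]
  and computable_rneg [comp_intros] = computable_compose[OF computable_rneg0]

text \<open>One form for all comparisons that occur later: \<open>m = 1\<close> for splitting sums,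
  the third rational 0 for averages, and \<open>m = 0\<close> for comparing a rational with the
  negative of another.\<close>

lemma decidable_rat_less:
  assumes "computable a" "computable b" "computable c" "computable m"
  shows "decidable (\<lambda>z. rat_enum (a z) * real (m z) < rat_enum (b z) + rat_enum (c z))"
proof -
  have *: "rat_enum a * real m < rat_enum b + rat_enum c \<longleftrightarrow>
    rpos a * m * (Suc (psnd b) * Suc (psnd c)) + rneg b * Suc (psnd c) * Suc (psnd a)
       + rneg c * Suc (psnd b) * Suc (psnd a)
    < rneg a * m * (Suc (psnd b) * Suc (psnd c)) + rpos b * Suc (psnd c) * Suc (psnd a)
       + rpos c * Suc (psnd b) * Suc (psnd a)" (is "?L \<longleftrightarrow> ?l < ?r") for a b c m :: nat
  proof -
    have frac: "(x - x') / \<alpha> * m < (y - y') / \<beta> + (z - z') / \<gamma> \<longleftrightarrow>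
        x * m * (\<beta> * \<gamma>) + y' * \<gamma> * \<alpha> + z' * \<beta> * \<alpha>
        < x' * m * (\<beta> * \<gamma>) + y * \<gamma> * \<alpha> + z * \<beta> * \<alpha>"
      if "0 < \<alpha>" "0 < \<beta>" "0 < \<gamma>" for x x' y y' z z' m \<alpha> \<beta> \<gamma> :: real
      using that by (simp add: divide_simps) (simp add: algebra_simps)
    have "?L \<longleftrightarrow> real ?l < real ?r"
      unfolding rat_enum_eq of_nat_add of_nat_mult by (rule frac) simp_all
    then show ?thesis by (simp only: of_nat_less_iff)
  qed
  show ?thesis unfolding * by (intro comp_intros assms)
qed

lemma ex_rat_enum: "r \<in> \<rat> \<Longrightarrow> \<exists>j. rat_enum j = r"
proof -
  assume "r \<in> \<rat>"
  then obtain p q where r: "r = of_int p / of_int q" "q > 0"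
    by (metis Rats_cases')
  then show ?thesis
    by (intro exI[of _ "prod_encode (int_encode p, nat q - 1)"])
      (simp add: rat_enum_def of_nat_diff Suc_nat_eq_nat_zadd1)
qed

lemma ex_rat_enum_between: "a < b \<Longrightarrow> \<exists>j. a < rat_enum j \<and> rat_enum j < b"
  using Rats_dense_in_real ex_rat_enum by blast

lemma rat_enum_pr_of_nat: "rat_enum (pr (2 * m) 0) = real m"
  by (simp add: rat_enum_eq rpos_def rneg_def)

section \<open>The effective Borel hierarchy\<close>

definition usig :: "(nat \<Rightarrow> 'a::polish_space) \<Rightarrow> nat \<Rightarrow> (nat \<Rightarrow> 'a set) \<Rightarrow> bool" where
  "usig s n A \<longleftrightarrow> uniformly (\<lambda>e A. A = Sigma0 s n e) A"

lemma usig_iff: "usig s n A \<longleftrightarrow> (\<exists>g. computable g \<and> A = (\<lambda>i. Sigma0 s n (g i)))"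
  by (auto simp: usig_def uniformly_def)

lemma usig_Sigma0: "computable g \<Longrightarrow> usig s n (\<lambda>z. Sigma0 s n (g z))"
  unfolding usig_iff by blast

lemma usig_compose: "usig s n A \<Longrightarrow> computable f \<Longrightarrow> usig s n (\<lambda>z. A (f z))"
  unfolding usig_iff by (auto intro!: computable_compose)

text \<open>The sets whose c.e. unions form level \<open>n\<close>; this gives level 1 and the
  higher levels a common description.\<close>

definition basic :: "(nat \<Rightarrow> 'a::polish_space) \<Rightarrow> nat \<Rightarrow> nat \<Rightarrow> 'a set" where
  "basic s n i = (if n = 1 then ideal_ball s i else - Sigma0 s (n - 1) i)"

lemma Sigma0_basic: "1 \<le> n \<Longrightarrow> Sigma0 s n e = (\<Union>i\<in>W e. basic s n i)"
  by (cases "(s, n, e)" rule: Sigma0.cases) (auto simp: basic_def)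

lemma usig_UN_basic:
  assumes "1 \<le> n" "ce (\<lambda>z. R (pfst z) (psnd z))"
  shows "usig s n (\<lambda>i. \<Union>j\<in>{j. R i j}. basic s n j)"
proof -
  from smn[OF assms(2)] obtain g where "computable g" "\<And>i. W (g i) = {j. R i j}" by auto
  then show ?thesis unfolding usig_iff by (intro exI[of _ g]) (simp add: Sigma0_basic[OF assms(1)])
qed

lemma usig_UN:
  assumes "1 \<le> n" "usig s n (\<lambda>z. A (pfst z) (psnd z))" "ce (\<lambda>z. R (pfst z) (psnd z))"
  shows "usig s n (\<lambda>i. \<Union>j\<in>{j. R i j}. A i j)"
proof -
  obtain g where g: "computable g" "(\<lambda>z. A (pfst z) (psnd z)) = (\<lambda>i. Sigma0 s n (g i))"
    using assms(2) unfolding usig_iff by blast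
  have A: "A i j = Sigma0 s n (g (pr i j))" for i j
    using fun_cong[OF g(2), of "pr i j"] by simp
  have "ce (\<lambda>z. \<exists>j. R (pfst z) j \<and> psnd z \<in> W (g (pr (pfst z) j)))"
  proof (intro ce_intros comp_intros computable_compose[OF g(1)])
    have "computable (\<lambda>z. pr (pfst (pfst z)) (psnd z))" by (intro comp_intros)
    from ce_compose[OF assms(3) this] show "ce (\<lambda>z. R (pfst (pfst z)) (psnd z))" by simp
  qed
  from usig_UN_basic[OF assms(1) this, of s]
  show ?thesis
    by (rule back_subst[where P="usig s n"]) (auto simp: A Sigma0_basic[OF assms(1)])
qed

lemma usig_Un:
  assumes "1 \<le> n" "usig s n A" "usig s n B"
  shows "usig s n (\<lambda>i. A i \<union> B i)"
proof -
  obtain g h where g: "computable g" "A = (\<lambda>i. Sigma0 s n (g i))"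
    and h: "computable h" "B = (\<lambda>i. Sigma0 s n (h i))"
    using assms unfolding usig_iff by blast
  have "ce (\<lambda>z. psnd z \<in> W (g (pfst z)) \<or> psnd z \<in> W (h (pfst z)))"
    by (intro ce_intros comp_intros computable_compose[OF g(1)] computable_compose[OF h(1)])
  from usig_UN_basic[OF assms(1) this, of s]
  show ?thesis
    by (rule back_subst[where P="usig s n"]) (auto simp: g h Sigma0_basic[OF assms(1)])
qed

text \<open>The condition is formal inclusion of ideal balls. Distances are only approximable, but a
  strict inequality is confirmed as soon as some approximation satisfies it with its error bound
  added.\<close>

lemma ce_dist_less:
  assumes "computable_metric_space s"
  shows "ce (\<lambda>z. dist (s (pfst (pfst z))) (s (pfst (psnd z))) + posrat_enum (psnd (pfst z))
            < posrat_enum (psnd (psnd z)))"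
proof -
  obtain g where g: "computable g"
    "\<And>k. computable_real_index (g k) (case prod_decode k of (i, j) \<Rightarrow> dist (s i) (s j))"
    using assms unfolding computable_metric_space_def uniformly_def by blast
  have g2: "computable_real_index (g (pr i j)) (dist (s i) (s j))" for i j
    using g(2)[of "pr i j"] by (simp add: prod_decode_pr)
  define Q where "Q j q q' t \<longleftrightarrow> (rat_enum j + (1/2) ^ t) + posrat_enum q < posrat_enum q'" for j q q' t
  define F where "F z t \<longleftrightarrow> (\<exists>j. phi (g (pr (pfst (pfst z)) (pfst (psnd z)))) t j \<and>
    Q j (psnd (pfst z)) (psnd (psnd z)) t)" for z t
  have Q: "Q j q q' t \<longleftrightarrow>
      rpos j * 2 ^ t * Suc (psnd q) * Suc (psnd q')
      + Suc (psnd j) * Suc (psnd q) * Suc (psnd q')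
      + Suc (pfst q) * Suc (psnd j) * 2 ^ t * Suc (psnd q')
     < Suc (pfst q') * Suc (psnd j) * 2 ^ t * Suc (psnd q)
      + rneg j * 2 ^ t * Suc (psnd q) * Suc (psnd q')" (is "_ \<longleftrightarrow> ?l < ?r") for j q q' t
  proof -
    have frac: "(x - x') / \<alpha> + 1 / \<tau> + y / \<beta> < z / \<gamma> \<longleftrightarrow>
        x * \<tau> * \<beta> * \<gamma> + \<alpha> * \<beta> * \<gamma> + y * \<alpha> * \<tau> * \<gamma> < z * \<alpha> * \<tau> * \<beta> + x' * \<tau> * \<beta> * \<gamma>"
      if "0 < \<alpha>" "0 < \<beta>" "0 < \<gamma>" "0 < \<tau>" for x x' y z \<alpha> \<beta> \<gamma> \<tau> :: real
      using that by (simp add: divide_simps) (simp add: algebra_simps)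
    have "Q j q q' t \<longleftrightarrow> real ?l < real ?r"
      unfolding Q_def rat_enum_eq posrat_enum_def prod_decode_pr prod.case power_one_over
        of_nat_add of_nat_mult of_nat_power of_nat_numeral
      by (rule frac) simp_all
    then show ?thesis by (simp only: of_nat_less_iff)
  qed
  have "ce (\<lambda>z. \<exists>t. F z t)"
    unfolding F_def Q
    by (intro ce_intros decidable_imp_ce comp_intros computable_compose[OF g(1)])
  moreover have "(\<exists>t. F z t) \<longleftrightarrow>
     dist (s (pfst (pfst z))) (s (pfst (psnd z))) + posrat_enum (psnd (pfst z))
       < posrat_enum (psnd (psnd z))" (is "_ \<longleftrightarrow> ?d + ?q < ?q'") for z
  proof
    assume "\<exists>t. F z t"
    then obtain t j where tj: "phi (g (pr (pfst (pfst z)) (pfst (psnd z)))) t j"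
      "rat_enum j + (1/2) ^ t + ?q < ?q'" by (auto simp: F_def Q_def)
    from g2[of "pfst (pfst z)" "pfst (psnd z)"] obtain j' where
      "phi (g (pr (pfst (pfst z)) (pfst (psnd z)))) t j'" "\<bar>rat_enum j' - ?d\<bar> \<le> (1/2) ^ t"
      unfolding computable_real_index_def by blast
    with tj phi_deterministic show "?d + ?q < ?q'" by fastforce
  next
    assume less: "?d + ?q < ?q'"
    \<comment> \<open>Half the gap, since the error of \<open>rat_enum j\<close> and the margin in
      \<open>Q\<close> each cost up to \<open>(1/2) ^ t\<close>.\<close>
    then obtain t where t: "(1/2::real) ^ t < (?q' - ?q - ?d) / 2"
      using real_arch_pow_inv[of "(?q' - ?q - ?d) / 2" "1/2"] by auto
    from g2[of "pfst (pfst z)" "pfst (psnd z)"] obtain j where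
      j: "phi (g (pr (pfst (pfst z)) (pfst (psnd z)))) t j" "\<bar>rat_enum j - ?d\<bar> \<le> (1/2) ^ t"
      unfolding computable_real_index_def by blast
    with t have "Q j (psnd (pfst z)) (psnd (psnd z)) t" unfolding Q_def by argo
    with j(1) show "\<exists>t. F z t" unfolding F_def by blast
  qed
  ultimately show ?thesis by simp
qed

lemma ideal_ball_pr: "ideal_ball s k = {x. dist x (s (pfst k)) < posrat_enum (psnd k)}"
  by (simp add: ideal_ball_def prod_decode_pr)

lemma ex_posrat_enum_less: "0 < (r::real) \<Longrightarrow> \<exists>j. 0 < posrat_enum j \<and> posrat_enum j < r"
proof -
  assume "0 < r"
  then obtain n where "inverse (of_nat (Suc n)) < r" using reals_Archimedean by blast
  then show ?thesis
    by (intro exI[of _ "pr 0 n"]) (simp add: posrat_enum_def prod_decode_pr field_simps)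
qed

text \<open>Formal inclusion implies inclusion by the triangle inequality, and by density every
  point of the intersection lies in a small ball formally included in both.\<close>

lemma ideal_ball_Int:
  assumes "closure (range s) = UNIV"
  shows "ideal_ball s i \<inter> ideal_ball s j =
    (\<Union>k\<in>{k. dist (s (pfst k)) (s (pfst i)) + posrat_enum (psnd k) < posrat_enum (psnd i) \<and>
        dist (s (pfst k)) (s (pfst j)) + posrat_enum (psnd k) < posrat_enum (psnd j)}. ideal_ball s k)"
    (is "?l = ?r")
proof
  have "dist x (s (pfst i)) < posrat_enum (psnd i)"
    if "dist (s (pfst k)) (s (pfst i)) + posrat_enum (psnd k) < posrat_enum (psnd i)"
      "dist x (s (pfst k)) < posrat_enum (psnd k)" for x i k
    using that dist_triangle[of x "s (pfst i)" "s (pfst k)"] by linarith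
  then show "?r \<subseteq> ?l" by (auto simp: ideal_ball_pr)
  show "?l \<subseteq> ?r"
  proof
    fix x assume "x \<in> ?l"
    then have x: "dist x (s (pfst i)) < posrat_enum (psnd i)" "dist x (s (pfst j)) < posrat_enum (psnd j)"
      by (auto simp: ideal_ball_pr)
    \<comment> \<open>Half the remaining room: one radius is lost in moving from \<open>x\<close> to
      the centre \<open>s l\<close>, and formal inclusion spends another.\<close>
    define r where "r = min (posrat_enum (psnd i) - dist x (s (pfst i)))
      (posrat_enum (psnd j) - dist x (s (pfst j))) / 2"
    have "r > 0" using x by (auto simp: r_def)
    then obtain q where q: "0 < posrat_enum q" "posrat_enum q < r" using ex_posrat_enum_less by blast
    have "x \<in> closure (range s)" using assms by simp
    with q(1) obtain l where l: "dist (s l) x < posrat_enum q"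
      unfolding closure_approachable by blast
    have "dist (s l) (s (pfst i)) \<le> dist (s l) x + dist x (s (pfst i))"
      "dist (s l) (s (pfst j)) \<le> dist (s l) x + dist x (s (pfst j))" by (rule dist_triangle)+
    moreover have "2 * r \<le> posrat_enum (psnd i) - dist x (s (pfst i))"
      "2 * r \<le> posrat_enum (psnd j) - dist x (s (pfst j))" by (auto simp: r_def)
    ultimately show "x \<in> ?r"
      using l q by (intro UN_I[of "pr l q"]) (auto simp: ideal_ball_pr dist_commute)
  qed
qed

text \<open>At level 1 the two balls are refined by smaller balls. Above it, the intersection of two
  complements is the complement of a union one level down, hence again a single basic set.\<close>

lemma usig_basic_Int:
  assumes "1 \<le> n" "computable_metric_space s"
  shows "usig s n (\<lambda>z. basic s n (pfst z) \<inter> basic s n (psnd z))"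
proof (cases "n = 1")
  case True
  let ?D = "\<lambda>k i. dist (s (pfst k)) (s (pfst i)) + posrat_enum (psnd k) < posrat_enum (psnd i)"
  have "computable (\<lambda>z. pr (psnd z) (pfst (pfst z)))" "computable (\<lambda>z. pr (psnd z) (psnd (pfst z)))"
    by (intro comp_intros)+
  from this[THEN ce_compose[OF ce_dist_less[OF assms(2)]]]
  have "ce (\<lambda>z. ?D (psnd z) (pfst (pfst z)) \<and> ?D (psnd z) (psnd (pfst z)))"
    by (intro ce_conj) simp_all
  from usig_UN_basic[OF assms(1) this, of s]
  show ?thesis
    using assms(2) unfolding computable_metric_space_def
    by (simp add: True basic_def ideal_ball_Int)
next
  case False
  define m where "m = n - 1"
  have b: "basic s n = (\<lambda>j. - Sigma0 s m j)" using False by (simp add: fun_eq_iff basic_def m_def)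
  have m: "1 \<le> m" using False assms(1) by (simp add: m_def)
  have "usig s m (\<lambda>z. Sigma0 s m (pfst z) \<union> Sigma0 s m (psnd z))"
    by (intro usig_Un m usig_Sigma0 comp_intros)
  then obtain g where g: "computable g"
      "\<And>z. Sigma0 s m (pfst z) \<union> Sigma0 s m (psnd z) = Sigma0 s m (g z)"
    unfolding usig_iff fun_eq_iff by blast
  have "ce (\<lambda>z. psnd z = g (pfst z))"
    by (intro decidable_imp_ce comp_intros computable_compose[OF g(1)])
  from usig_UN_basic[OF assms(1) this, of s]
  show ?thesis
    by (rule back_subst[where P="usig s n"]) (auto simp: b g(2)[symmetric])
qed

lemma usig_Int:
  assumes "1 \<le> n" "computable_metric_space s" "usig s n A" "usig s n B"
  shows "usig s n (\<lambda>i. A i \<inter> B i)"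
proof -
  obtain g h where g: "computable g" "A = (\<lambda>i. Sigma0 s n (g i))"
    and h: "computable h" "B = (\<lambda>i. Sigma0 s n (h i))"
    using assms unfolding usig_iff by blast
  have "ce (\<lambda>z. pfst (psnd z) \<in> W (g (pfst z)) \<and> psnd (psnd z) \<in> W (h (pfst z)))"
    by (intro ce_intros comp_intros computable_compose[OF g(1)] computable_compose[OF h(1)])
  from usig_UN[OF assms(1) usig_compose[OF usig_basic_Int[OF assms(1,2)] computable_psnd0] this]
  have "usig s n (\<lambda>i. \<Union>j\<in>{j. pfst j \<in> W (g i) \<and> psnd j \<in> W (h i)}.
      basic s n (pfst j) \<inter> basic s n (psnd j))" .
  moreover have "(\<Union>j\<in>{j. pfst j \<in> W (g i) \<and> psnd j \<in> W (h i)}.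
      basic s n (pfst j) \<inter> basic s n (psnd j)) = A i \<inter> B i" for i
  proof (intro equalityI subsetI)
    fix x assume "x \<in> A i \<inter> B i"
    then obtain j k where "j \<in> W (g i)" "x \<in> basic s n j" "k \<in> W (h i)" "x \<in> basic s n k"
      by (auto simp: g h Sigma0_basic[OF assms(1)])
    then show "x \<in> (\<Union>j\<in>{j. pfst j \<in> W (g i) \<and> psnd j \<in> W (h i)}.
      basic s n (pfst j) \<inter> basic s n (psnd j))" by (intro UN_I[of "pr j k"]) auto
  qed (auto simp: g h Sigma0_basic[OF assms(1)])
  ultimately show ?thesis by simp
qed

text \<open>Takes sections of c.e. sets of pairs, so that one number \<open>e\<close> codes the
  family of sets \<open>W (sec (pr e r))\<close>. It is fixed as a constant because the step
  hypothesis of the recursion lemma below has to mention it.\<close>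

definition sec :: "nat \<Rightarrow> nat" where
  "sec = (SOME g. computable g \<and> (\<forall>z. W (g z) = {k. pr (psnd z) k \<in> W (pfst z)}))"

lemma computable_sec0: "computable sec" and W_sec: "W (sec (pr e r)) = {k. pr r k \<in> W e}"
proof -
  have "ce (\<lambda>z. pr (psnd (pfst z)) (psnd z) \<in> W (pfst (pfst z)))"
    by (intro ce_intros comp_intros)
  from smn[OF this] have "\<exists>g. computable g \<and> (\<forall>z. W (g z) = {k. pr (psnd z) k \<in> W (pfst z)})"
    by simp
  from someI_ex[OF this, folded sec_def]
  show "computable sec" "W (sec (pr e r)) = {k. pr r k \<in> W e}" by auto
qed

text \<open>A whole family \<open>F N\<close> is coded by the single index \<open>e N\<close> of a c.e. set of pairs, so that
  the recursion on families becomes primitive recursion on indices.\<close>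

lemma usig_rec:
  assumes n: "1 \<le> n" and base: "usig s n (F 0)"
    and step: "usig s n (\<lambda>z. \<Phi> (\<lambda>r. Sigma0 s n (sec (pr (pfst z) r))) (pfst (psnd z)) (psnd (psnd z)))"
    and F: "\<And>N j. F (Suc N) j = \<Phi> (F N) N j"
  shows "usig s n (\<lambda>z. F (pfst z) (psnd z))"
proof -
  obtain g where g: "computable g" "F 0 = (\<lambda>r. Sigma0 s n (g r))"
    using base unfolding usig_iff by blast
  obtain h where h: "computable h"
    "\<And>z. \<Phi> (\<lambda>r. Sigma0 s n (sec (pr (pfst z) r))) (pfst (psnd z)) (psnd (psnd z)) = Sigma0 s n (h z)"
    using step unfolding usig_iff fun_eq_iff by blast
  have "ce (\<lambda>z. psnd z \<in> W (g (pfst z)))"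
    by (intro ce_intros comp_intros computable_compose[OF g(1)])
  then obtain e0 where "W e0 = {z. psnd z \<in> W (g (pfst z))}" unfolding ce_def by blast
  then have e0: "W (sec (pr e0 r)) = W (g r)" for r by (simp add: W_sec)
  have "ce (\<lambda>z. psnd (psnd z) \<in> W (h (pr (pfst (pfst z)) (pr (psnd (pfst z)) (pfst (psnd z))))))"
    by (intro ce_intros comp_intros computable_compose[OF h(1)])
  \<comment> \<open>If \<open>e\<close> codes the family of stage \<open>N\<close>, then
    \<open>\<psi> (pr e N)\<close> codes that of stage \<open>Suc N\<close>.\<close>
  from smn[OF this] obtain \<psi> where \<psi>: "computable \<psi>"
    "\<And>z. W (\<psi> z) = {x. psnd x \<in> W (h (pr (pfst z) (pr (psnd z) (pfst x))))}" by auto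
  define e where "e N = rec_nat e0 (\<lambda>N e. \<psi> (pr e N)) N" for N
  have "computable e"
    unfolding e_def by (intro computable_rec comp_intros computable_compose[OF \<psi>(1)])
  have "F N r = Sigma0 s n (sec (pr (e N) r))" for N r
  proof (induction N arbitrary: r)
    case 0
    show ?case by (simp add: g(2) Sigma0_basic[OF n] e0 e_def)
  next
    case (Suc N)
    have "F (Suc N) r = Sigma0 s n (h (pr (e N) (pr N r)))"
      using h(2)[of "pr (e N) (pr N r)"] ext[of "F N", OF Suc] by (simp add: F)
    also have "\<dots> = Sigma0 s n (sec (pr (e (Suc N)) r))"
      by (simp add: Sigma0_basic[OF n] e_def \<psi>(2) W_sec)
    finally show ?case .
  qed
  then have "(\<lambda>z. F (pfst z) (psnd z)) = (\<lambda>z. Sigma0 s n (sec (pr (e (pfst z)) (psnd z))))" by simp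
  then show ?thesis
    by (simp only:) (intro usig_Sigma0 computable_compose[OF computable_sec0]
        computable_compose[OF \<open>computable e\<close>] comp_intros)
qed

section \<open>Measurability of the hierarchy and preimages under the transformation\<close>

lemma open_ideal_ball: "open (ideal_ball s k)"
  by (simp add: ideal_ball_pr open_Collect_less continuous_intros)

lemma Sigma0_borel: "Sigma0 s n e \<in> sets borel"
  by (induction s n e rule: Sigma0.induct) (auto intro!: borel_open open_ideal_ball sets.countable_UN')

text \<open>Stated pointwise on \<open>dom T\<close> because an equivalence passes to complements
  and so climbs the hierarchy; the preimage itself has the right complexity only relative to
  \<open>dom T\<close>.\<close>

lemma pvimage_Sigma0:
  assumes "computable_transformation s T" "1 \<le> n"
  shows "\<exists>t. computable t \<and> (\<forall>x y e. T x = Some y \<longrightarrow> (y \<in> Sigma0 s n e \<longleftrightarrow> x \<in> Sigma0 s n (t e)))"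
  using assms(2)
proof (induction n rule: dec_induct)
  case base
  obtain g where g: "computable g" "\<And>i. pvimage T (ideal_ball s i) = dom T \<inter> Sigma0 s 1 (g i)"
    using assms(1) unfolding computable_transformation_def uniformly_def Sigma0_in_index_def by blast
  have "ce (\<lambda>z. \<exists>k. k \<in> W (pfst z) \<and> psnd z \<in> W (g k))"
    by (intro ce_intros comp_intros computable_compose[OF g(1)])
  from smn[OF this] obtain t where t: "computable t" "\<And>e. W (t e) = {x. \<exists>k. k \<in> W e \<and> x \<in> W (g k)}"
    by auto
  have ball: "y \<in> ideal_ball s i \<longleftrightarrow> x \<in> Sigma0 s 1 (g i)" if "T x = Some y" for x y i
  proof -
    have "y \<in> ideal_ball s i \<longleftrightarrow> x \<in> pvimage T (ideal_ball s i)" using that by (auto simp: pvimage_def)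
    then show ?thesis unfolding g(2) using that by auto
  qed
  then have "y \<in> Sigma0 s 1 e \<longleftrightarrow> x \<in> Sigma0 s 1 (t e)" if "T x = Some y" for x y e
  proof -
    have "y \<in> Sigma0 s 1 e \<longleftrightarrow> (\<exists>i\<in>W e. y \<in> ideal_ball s i)" by simp
    also have "\<dots> \<longleftrightarrow> (\<exists>i\<in>W e. x \<in> Sigma0 s 1 (g i))" by (simp only: ball[OF that])
    also have "\<dots> \<longleftrightarrow> x \<in> Sigma0 s 1 (t e)" by (auto simp: t(2))
    finally show ?thesis .
  qed
  then show ?case using t(1) by (intro exI[of _ t] conjI allI impI)
next
  case (step n)
  then obtain t where t: "computable t"
    "\<And>x y e. T x = Some y \<Longrightarrow> y \<in> Sigma0 s n e \<longleftrightarrow> x \<in> Sigma0 s n (t e)" by blast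
  have "ce (\<lambda>z. \<exists>k. k \<in> W (pfst z) \<and> psnd z = t k)"
    by (intro ce_intros decidable_imp_ce comp_intros computable_compose[OF t(1)])
  from smn[OF this] obtain u where u: "computable u" "\<And>e. W (u e) = {x. \<exists>k. k \<in> W e \<and> x = t k}"
    by auto
  have S: "Sigma0 s (Suc n) e = (\<Union>i\<in>W e. - Sigma0 s n i)" for e
    using step.hyps by (cases n) auto
  have "y \<in> Sigma0 s (Suc n) e \<longleftrightarrow> x \<in> Sigma0 s (Suc n) (u e)" if "T x = Some y" for x y e
    using t(2)[OF that] unfolding S u(2) by blast
  then show ?case using u(1) by (intro exI[of _ u] conjI allI impI)
qed

lemma piter_Sigma0:
  assumes t: "\<And>x y e. T x = Some y \<Longrightarrow> y \<in> Sigma0 s n e \<longleftrightarrow> x \<in> Sigma0 s n (t e)"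
    and "piter T k x = Some y"
  shows "y \<in> Sigma0 s n e \<longleftrightarrow> x \<in> Sigma0 s n ((t ^^ k) e)"
  using assms(2)
proof (induction k arbitrary: y e)
  case (Suc k)
  then obtain z where z: "piter T k x = Some z" "T z = Some y" by (auto simp: map_comp_Some_iff)
  then show ?case using t[OF z(2)] Suc.IH[OF z(1)] by (simp add: funpow_swap1)
qed auto

section \<open>Upcrossings of averages of a real sequence\<close>

definition psum :: "(nat \<Rightarrow> real) \<Rightarrow> nat \<Rightarrow> real" where "psum y k = (\<Sum>i<k. y i)"

text \<open>
  With \<open>p k = psum y k - b k\<close> and \<open>r k = psum y k - a k\<close>, the second component is the maximum of
  \<open>\<Sum>j. p (v\<^sub>j) - r (u\<^sub>j)\<close> over all \<open>u\<^sub>1 \<le> v\<^sub>1 < u\<^sub>2 \<le> v\<^sub>2 < \<dots> \<le> k\<close>; the first one also subtracts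
  \<open>r\<close> at a last, unmatched \<open>u\<close>.  Passing from \<open>y\<close> to its shift increases the value of each pair by
  \<open>b - a\<close>, and genuine upcrossings can be merged into a maximal sequence without loss.
\<close>

fun gains :: "(nat \<Rightarrow> real) \<Rightarrow> real \<Rightarrow> real \<Rightarrow> nat \<Rightarrow> real \<times> real" where
  "gains y a b 0 = (0, 0)"
| "gains y a b (Suc k) = (case gains y a b k of (i, w) \<Rightarrow>
    let i' = max i (w - (psum y (Suc k) - a * real (Suc k))) in
      (i', max w (i' + (psum y (Suc k) - b * real (Suc k)))))"

definition gain_in where "gain_in y a b k = fst (gains y a b k)"
definition gain_out where "gain_out y a b k = snd (gains y a b k)"

lemma gain_0 [simp]: "gain_in y a b 0 = 0" "gain_out y a b 0 = 0"
  by (simp_all add: gain_in_def gain_out_def)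

lemma gain_in_Suc: "gain_in y a b (Suc k) =
    max (gain_in y a b k) (gain_out y a b k - (psum y (Suc k) - a * real (Suc k)))"
  and gain_out_Suc: "gain_out y a b (Suc k) =
    max (gain_out y a b k) (gain_in y a b (Suc k) + (psum y (Suc k) - b * real (Suc k)))"
  by (simp_all add: gain_in_def gain_out_def Let_def split: prod.split)

text \<open>
  Even phases wait for an average above \<open>b\<close>, odd ones for an average below \<open>a\<close>.  Phase 0 is even, so
  an initial rise above \<open>b\<close> counts as an upcrossing.
\<close>

primrec phase :: "(nat \<Rightarrow> real) \<Rightarrow> real \<Rightarrow> real \<Rightarrow> nat \<Rightarrow> nat" where
  "phase y a b 0 = 0"
| "phase y a b (Suc k) = phase y a b k +
    of_bool (if even (phase y a b k) then b * real (Suc k) < psum y (Suc k)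
      else psum y (Suc k) < a * real (Suc k))"

lemma psum_shift: "psum y (Suc k) = y 0 + psum (\<lambda>i. y (Suc i)) k"
  unfolding psum_def by (rule sum.lessThan_Suc_shift)

text \<open>
  One step of the comparison of \<open>y\<close> (unprimed) with its shift (primed): \<open>i, u\<close> are the two components
  of \<^const>\<open>gains\<close> and \<open>D\<close> is \<open>d = b - a\<close> times the number of upcrossings so far.
\<close>

lemma gain_step_even:
  fixes i u i' u' i1 u1 i1' u1' d D p r :: real
  assumes "0 \<le> d" "p \<le> r"
    and i1: "i1 = max i (u - r)" and u1: "u1 = max u (i1 + p)"
    and i1': "i1' = max i' (u' - r)" and u1': "u1' = max u' (i1' + p + d)"
    and inv: "i + D \<le> i'" "u + D \<le> max i' (u' - d)" "u + D \<le> u'"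
  shows "p \<ge> 0 \<Longrightarrow> u1 + D + d \<le> u1' \<and> i1 + D + d \<le> max u1' i1' \<and> i1 + D \<le> i1'"
    and "i1 + D \<le> i1' \<and> u1 + D \<le> max i1' (u1' - d) \<and> u1 + D \<le> u1'"
proof -
  \<comment> \<open>The primed quantities enter only through lower bounds, the unprimed ones through
    the branch at which each maximum is attained.\<close>
  have *: "i' \<le> i1'" "u' - r \<le> i1'" "u' \<le> u1'" "i1' + p + d \<le> u1'"
    "i1 = i \<or> i1 = u - r" "u1 = u \<or> u1 = i1 + p" "u + D \<le> i' \<or> u + D \<le> u' - d"
    using inv unfolding i1 u1 i1' u1' le_max_iff_disj by auto
  show "p \<ge> 0 \<Longrightarrow> u1 + D + d \<le> u1' \<and> i1 + D + d \<le> max u1' i1' \<and> i1 + D \<le> i1'"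
    and "i1 + D \<le> i1' \<and> u1 + D \<le> max i1' (u1' - d) \<and> u1 + D \<le> u1'"
    unfolding le_max_iff_disj using * assms(1,2) inv(1,3) by argo+
qed

lemma gain_step_odd:
  fixes i u i' u' i1 u1 i1' u1' d D p r :: real
  assumes "0 \<le> d" "p \<le> r"
    and i1: "i1 = max i (u - r)" and u1: "u1 = max u (i1 + p)"
    and i1': "i1' = max i' (u' - r)" and u1': "u1' = max u' (i1' + p + d)"
    and inv: "u + D \<le> u'" "i + D \<le> max u' i'" "i + D - d \<le> i'"
  shows "r \<le> 0 \<Longrightarrow> i1 + D \<le> i1' \<and> u1 + D \<le> max i1' (u1' - d) \<and> u1 + D \<le> u1'"
    and "u1 + D \<le> u1' \<and> i1 + D \<le> max u1' i1' \<and> i1 + D - d \<le> i1'"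
proof -
  have *: "i' \<le> i1'" "u' - r \<le> i1'" "u' \<le> u1'" "i1' + p + d \<le> u1'"
    "i1 = i \<or> i1 = u - r" "u1 = u \<or> u1 = i1 + p" "i + D \<le> u' \<or> i + D \<le> i'"
    using inv unfolding i1 u1 i1' u1' le_max_iff_disj by auto
  show "r \<le> 0 \<Longrightarrow> i1 + D \<le> i1' \<and> u1 + D \<le> max i1' (u1' - d) \<and> u1 + D \<le> u1'"
    and "u1 + D \<le> u1' \<and> i1 + D \<le> max u1' i1' \<and> i1 + D - d \<le> i1'"
    unfolding le_max_iff_disj using * assms(1,2) inv(1,3) by argo+
qed

text \<open>Dropping the first term changes \<open>r\<close> to \<open>r - c\<close> and
  \<open>p\<close> to \<open>p + d - c\<close>. Subtracting \<open>c\<close> from the inner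
  component absorbs this: \<open>I\<close>, \<open>U\<close> obey the recursion of \<open>i\<close>,
  \<open>u\<close>, except that every exit pays \<open>d\<close> more. The offset
  \<open>max 0 c\<close> makes \<open>I 0 = i 0\<close>. The clauses with \<open>max\<close> express
  the merging of upcrossings. In an even phase, a best closed choice for \<open>y\<close> is matched
  either with a surplus \<open>d\<close> already, or by an open choice that can exit, and collect
  \<open>d\<close>, once the average exceeds \<open>b\<close>. In an odd phase, a best open choice
  is matched either by an open one, or by a closed one that can enter without loss once the average
  falls below \<open>a\<close>.\<close>

lemma gain_shift_invariant:
  fixes y :: "nat \<Rightarrow> real" and a b :: real
  assumes "a \<le> b"
  defines "d \<equiv> b - a" and "c \<equiv> y 0 - a" and "y' \<equiv> \<lambda>i. y (Suc i)"
  defines "I \<equiv> \<lambda>k. gain_in y' a b k - c + max 0 c" and "U \<equiv> \<lambda>k. gain_out y' a b k + max 0 c"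
  defines "i \<equiv> \<lambda>k. gain_in y a b (Suc k)" and "u \<equiv> \<lambda>k. gain_out y a b (Suc k)"
    and "l \<equiv> \<lambda>k. phase y a b (Suc k)"
  defines "D \<equiv> \<lambda>k. d * real (Suc (l k) div 2)"
  shows "if even (l k)
    then i k + D k \<le> I k \<and> u k + D k \<le> max (I k) (U k - d) \<and> u k + D k \<le> U k
    else u k + D k \<le> U k \<and> i k + D k \<le> max (U k) (I k) \<and> i k + D k - d \<le> I k"
proof (induction k)
  case 0
  have "0 \<le> d" using assms(1) by (simp add: d_def)
  moreover have "y 0 - b = c - d" by (simp add: c_def d_def)
  moreover have "b < y 0 \<longleftrightarrow> d < c" by (auto simp: c_def d_def)
  moreover have "i 0 = max 0 (- c)"
    by (simp add: i_def gain_in_Suc psum_def c_def)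
  moreover have "u 0 = max 0 (i 0 + (c - d))"
    by (simp add: i_def u_def gain_out_Suc[of y a b 0] psum_def c_def d_def)
  moreover have "I 0 = max 0 c - c" "U 0 = max 0 c"
    by (simp_all add: I_def U_def)
  moreover have "l 0 = of_bool (b < y 0)" by (simp add: l_def psum_def)
  ultimately show ?case
    by (cases "d < c"; cases "0 \<le> c") (auto simp: D_def)
next
  case (Suc k)
  define r p where "r = psum y (k + 2) - a * real (k + 2)" and "p = psum y (k + 2) - b * real (k + 2)"
  have d: "0 \<le> d" using assms(1) by (simp add: d_def)
  have pr: "p \<le> r" using assms(1) by (simp add: p_def r_def mult_right_mono)
  have i: "i (Suc k) = max (i k) (u k - r)" and u: "u (Suc k) = max (u k) (i (Suc k) + p)"
    by (simp_all add: i_def u_def gain_in_Suc[of y a b "Suc k"] gain_out_Suc[of y a b "Suc k"] r_def p_def)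
  have sh: "psum y' (Suc k) = psum y (k + 2) - y 0"
    unfolding y'_def using psum_shift[of y "Suc k"] by simp
  have I: "I (Suc k) = max (I k) (U k - r)" 
    unfolding I_def U_def gain_in_Suc sh r_def c_def by (simp add: algebra_simps max_def)
  have U: "U (Suc k) = max (U k) (I (Suc k) + p + d)"
    unfolding I_def U_def gain_out_Suc sh p_def c_def d_def by (simp add: algebra_simps max_def)
  have l: "l (Suc k) = l k + of_bool (if even (l k) then 0 < p else r < 0)"
    by (simp add: l_def p_def r_def)
  show ?case
  proof (cases "even (l k)")
    case True
    then have inv: "i k + D k \<le> I k" "u k + D k \<le> max (I k) (U k - d)" "u k + D k \<le> U k"
      using Suc by auto
    note step = gain_step_even[OF d pr i u I U inv]
    show ?thesis
    proof (cases "0 < p")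
      case p: True
      have "D (Suc k) = D k + d"
        using True p by (auto simp: D_def l algebra_simps elim!: evenE)
      then show ?thesis using step(1) p True by (simp add: l)
    next
      case False
      then have "D (Suc k) = D k" using True by (simp add: D_def l)
      then show ?thesis using step(2) False True by (simp add: l)
    qed
  next
    case odd: False
    then have inv: "u k + D k \<le> U k" "i k + D k \<le> max (U k) (I k)" "i k + D k - d \<le> I k"
      using Suc by auto
    note step = gain_step_odd[OF d pr i u I U inv]
    show ?thesis
    proof (cases "r < 0")
      case r: True
      have "D (Suc k) = D k"
        using odd r by (auto simp: D_def l elim!: oddE)
      then show ?thesis using step(1) r odd by (simp add: l)
    next
      case False
      then have "D (Suc k) = D k" using odd by (simp add: D_def l)
      then show ?thesis using step(2) False odd by (simp add: l)
    qed
  qed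
qed

lemma gain_out_mono: "gain_out y a b k \<le> gain_out y a b (Suc k)"
  by (simp add: gain_out_Suc)

text \<open>Both branches of the invariant contain \<open>u k + D k \<le> U k\<close>. Lowering the
  index of \<open>gain_out y\<close> from \<open>Suc k\<close> to \<open>k\<close> puts both
  sequences at the same stage, so that their difference will integrate to 0.\<close>

lemma upcrossings_le_gain:
  assumes "a \<le> b"
  shows "(b - a) * real (Suc (phase y a b (Suc k)) div 2)
    \<le> gain_out (\<lambda>i. y (Suc i)) a b k - gain_out y a b k + max 0 (y 0 - a)"
  using gain_shift_invariant[OF assms, of y k] gain_out_mono[of y a b k]
  by (simp del: phase.simps split: if_splits)

lemma phase_mono: "k \<le> l \<Longrightarrow> phase y a b k \<le> phase y a b l"
  by (rule lift_Suc_mono_le[of "phase y a b"]) auto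

text \<open>The index \<open>N\<close> stands for the average of the first \<open>N + 1\<close> terms, and \<open>m\<close> for \<open>m + 1\<close> upcrossings.\<close>

primrec upcross :: "(nat \<Rightarrow> real) \<Rightarrow> real \<Rightarrow> real \<Rightarrow> nat \<Rightarrow> nat \<Rightarrow> bool" where
  "upcross y a b 0 N \<longleftrightarrow> b * real (Suc N) < psum y (Suc N)"
| "upcross y a b (Suc m) N \<longleftrightarrow> (\<exists>K L. upcross y a b m K \<and> K < L \<and> L < N \<and>
     psum y (Suc L) < a * real (Suc L) \<and> b * real (Suc N) < psum y (Suc N))"

text \<open>The phases advance at the first opportunity, so they are never behind an arbitrary
  choice of crossing times.\<close>

lemma upcross_phase: "upcross y a b m N \<Longrightarrow> 2 * m + 1 \<le> phase y a b (Suc N)"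
proof (induction m arbitrary: N)
  case 0
  then show ?case by (cases "even (phase y a b N)") (auto dest: odd_pos)
next
  case (Suc m)
  then obtain K L where *: "2 * m + 1 \<le> phase y a b (Suc K)" "K < L" "L < N"
     "psum y (Suc L) < a * real (Suc L)" "b * real (Suc N) < psum y (Suc N)" by auto
  have "phase y a b (Suc K) \<le> phase y a b L" using * by (intro phase_mono) auto
  then have "2 * m + 1 \<le> phase y a b L" using * by simp
  then have "2 * m + 2 \<le> phase y a b (Suc L)"
    using *(4) by (cases "phase y a b L = 2 * m + 1") auto
  also have "\<dots> \<le> phase y a b N" using * by (intro phase_mono) auto
  finally have "2 * m + 2 \<le> phase y a b N" .
  then have "2 * m + 3 \<le> phase y a b (Suc N)"
    using *(5) by (cases "phase y a b N = 2 * m + 2") auto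
  then show ?case by simp
qed

lemma upcross_gain:
  assumes "a \<le> b" "upcross y a b m N" "N \<le> k"
  shows "(b - a) * real (Suc m)
    \<le> gain_out (\<lambda>i. y (Suc i)) a b k - gain_out y a b k + max 0 (y 0 - a)"
proof -
  have "2 * m + 1 \<le> phase y a b (Suc k)"
    using upcross_phase[OF assms(2)] phase_mono[of "Suc N" "Suc k" y a b] assms(3) by linarith
  then have "Suc m \<le> Suc (phase y a b (Suc k)) div 2" by linarith
  then have "(b - a) * real (Suc m) \<le> (b - a) * real (Suc (phase y a b (Suc k)) div 2)"
    using assms(1) by (intro mult_left_mono) auto
  also note upcrossings_le_gain[OF assms(1), of y k]
  finally show ?thesis .
qed

text \<open>Doob's criterion: if the lower limit is below the upper one, some rational interval
  between them is crossed for ever. The bound \<open>B\<close> keeps the common value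
  finite.\<close>

lemma averages_convergent:
  assumes bound: "\<And>N. \<bar>psum y (Suc N)\<bar> \<le> B * real (Suc N)"
    and up: "\<And>a b. a \<in> \<rat> \<Longrightarrow> b \<in> \<rat> \<Longrightarrow> a < b \<Longrightarrow> \<exists>m. \<forall>N. \<not> upcross y a b m N"
  shows "\<exists>L. (\<lambda>N. psum y N / real N) \<longlonglongrightarrow> L"
proof -
  define A where "A N = psum y (Suc N) / real (Suc N)" for N
  have A_less: "A N < q \<longleftrightarrow> psum y (Suc N) < q * real (Suc N)"
    and less_A: "q < A N \<longleftrightarrow> q * real (Suc N) < psum y (Suc N)" for N q
    by (simp_all add: A_def divide_less_eq less_divide_eq)
  have bA: "\<bar>A N\<bar> \<le> B" for N
    using bound[of N] by (simp add: A_def divide_le_eq abs_divide)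
  have "liminf (\<lambda>N. ereal (A N)) = limsup (\<lambda>N. ereal (A N))"
  proof (rule ccontr)
    assume "liminf (\<lambda>N. ereal (A N)) \<noteq> limsup (\<lambda>N. ereal (A N))"
    then have "liminf (\<lambda>N. ereal (A N)) < limsup (\<lambda>N. ereal (A N))"
      using Liminf_le_Limsup[of sequentially "\<lambda>N. ereal (A N)"] by simp
    then obtain p where p: "liminf (\<lambda>N. ereal (A N)) < ereal p" "ereal p < limsup (\<lambda>N. ereal (A N))"
      using ereal_dense2 by blast
    from p(2) obtain q where pq: "ereal p < ereal q" "ereal q < limsup (\<lambda>N. ereal (A N))"
      using ereal_dense2 by blast
    from pq(1) obtain a where a: "a \<in> \<rat>" "p < a" "a < q" using Rats_dense_in_real[of p q] by auto
    from a(3) obtain b where b: "b \<in> \<rat>" "a < b" "b < q" using Rats_dense_in_real[of a q] by auto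
    have low: "\<exists>N>K. A N < a" for K
    proof (rule ccontr)
      assume "\<not> ?thesis"
      then have "\<forall>N>K. ereal a \<le> ereal (A N)" by (meson ereal_less_eq(3) not_less)
      then have "ereal a \<le> liminf (\<lambda>N. ereal (A N))"
        by (intro Liminf_bounded eventually_sequentiallyI[of "Suc K"]) (blast intro: Suc_le_lessD)
      then have "ereal a < ereal p" using p(1) by (rule le_less_trans)
      with a(2) show False by simp
    qed
    have high: "\<exists>N>K. b < A N" for K
    proof (rule ccontr)
      assume "\<not> ?thesis"
      then have "\<forall>N>K. ereal (A N) \<le> ereal b" by (meson ereal_less_eq(3) not_less)
      then have "limsup (\<lambda>N. ereal (A N)) \<le> ereal b"
        by (intro Limsup_bounded eventually_sequentiallyI[of "Suc K"]) (blast intro: Suc_le_lessD)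
      with pq(2) have "ereal q < ereal b" by (rule less_le_trans)
      with b(3) show False by simp
    qed
    have "\<exists>N. upcross y a b m N" for m
    proof (induction m)
      case 0
      show ?case using high[of 0] by (auto simp: less_A)
    next
      case (Suc m)
      then obtain K where "upcross y a b m K" ..
      moreover from low[of K] obtain L where "K < L" "A L < a" by blast
      moreover from high[of L] obtain N where "L < N" "b < A N" by blast
      ultimately show ?case by (auto simp: less_A A_less)
    qed
    then show False using up[OF a(1) b(1,2)] by blast
  qed
  then obtain l where l: "(\<lambda>N. ereal (A N)) \<longlonglongrightarrow> l"
    using Liminf_eq_Limsup[OF trivial_limit_sequentially] by blast
  have "- ereal B \<le> l"
    using bA by (intro LIMSEQ_le_const[OF l]) (auto simp: abs_le_iff minus_le_iff)
  moreover have "l \<le> ereal B"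
    using bA by (intro LIMSEQ_le_const2[OF l]) (auto simp: abs_le_iff)
  ultimately obtain r where "l = ereal r" by (cases l) auto
  with l have "A \<longlonglongrightarrow> r" by simp
  then show ?thesis unfolding A_def by (subst (asm) filterlim_sequentially_Suc) blast
qed

section \<open>Upcrossings under a measure-preserving map\<close>

locale preserving = prob_space P for P :: "'a measure" +
  fixes S :: "'a \<Rightarrow> 'a"
  assumes measurable_S [measurable]: "S \<in> P \<rightarrow>\<^sub>M P" and distr_S: "distr P P S = P"
begin

lemma measurable_funpow [measurable]: "(S ^^ k) \<in> P \<rightarrow>\<^sub>M P"
  by (induction k) (auto simp: id_def[symmetric] intro: measurable_comp measurable_S)

lemma AE_S: "AE x in P. Q x \<Longrightarrow> AE x in P. Q (S x)"
  by (rule AE_distrD[OF measurable_S]) (unfold distr_S)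

lemma AE_funpow: "AE x in P. Q x \<Longrightarrow> AE x in P. Q ((S ^^ k) x)"
proof (induction k)
  case (Suc k)
  then have "AE x in P. Q ((S ^^ k) (S x))" by (intro AE_S[where Q="\<lambda>x. Q ((S ^^ k) x)"])
  then show ?case by (simp add: funpow_swap1)
qed simp

lemma integral_S: "integrable P g \<Longrightarrow> integrable P (\<lambda>x. g (S x)) \<and> (\<integral>x. g (S x) \<partial>P) = (\<integral>x. g x \<partial>P)"
  for g :: "'a \<Rightarrow> real"
  using integrable_distr[OF measurable_S, of g] integral_distr[OF measurable_S, of g]
  by (simp add: distr_S)

lemma integral_funpow:
  "integrable P g \<Longrightarrow> integrable P (\<lambda>x. g ((S ^^ k) x)) \<and> (\<integral>x. g ((S ^^ k) x) \<partial>P) = (\<integral>x. g x \<partial>P)"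
  for g :: "'a \<Rightarrow> real"
proof (induction k)
  case (Suc k)
  then show ?case using integral_S[of "\<lambda>x. g ((S ^^ k) x)"] by (simp add: funpow_swap1)
qed simp

lemma measurable_psum [measurable]:
  assumes [measurable]: "g \<in> borel_measurable P"
  shows "(\<lambda>x. psum (\<lambda>k. g ((S ^^ k) x)) N) \<in> borel_measurable P"
  unfolding psum_def by measurable

lemma measurable_upcross [measurable]:
  assumes [measurable]: "g \<in> borel_measurable P"
  shows "Measurable.pred P (\<lambda>x. upcross (\<lambda>k. g ((S ^^ k) x)) a b m N)"
proof (induction m arbitrary: N)
  case (Suc m)
  note [measurable] = this
  show ?case unfolding upcross.simps by measurable
qed simp

lemma integrable_gains:
  assumes "integrable P g"
  shows "integrable P (\<lambda>x. gain_in (\<lambda>k. g ((S ^^ k) x)) a b N) \<and>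
    integrable P (\<lambda>x. gain_out (\<lambda>k. g ((S ^^ k) x)) a b N)"
proof (induction N)
  case (Suc N)
  have [simp]: "integrable P (\<lambda>x. psum (\<lambda>k. g ((S ^^ k) x)) K)" for K
    unfolding psum_def using integral_funpow[OF assms] by auto
  have "integrable P (\<lambda>x. gain_in (\<lambda>k. g ((S ^^ k) x)) a b (Suc N))"
    unfolding gain_in_Suc using Suc by (intro integrable_max Bochner_Integration.integrable_diff) auto
  moreover from this have "integrable P (\<lambda>x. gain_out (\<lambda>k. g ((S ^^ k) x)) a b (Suc N))"
    unfolding gain_out_Suc using Suc
    by (intro integrable_max Bochner_Integration.integrable_diff Bochner_Integration.integrable_add) auto
  ultimately show ?case ..
qed simp

text \<open>By invariance the difference of the gains of \<open>S x\<close> and \<open>x\<close> integrates to 0.\<close>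

lemma prob_upcross_le:
  assumes g: "integrable P g" and ab: "a < b"
  shows "prob {x \<in> space P. \<exists>N. upcross (\<lambda>k. g ((S ^^ k) x)) a b m N}
    \<le> (\<integral>x. max 0 (g x - a) \<partial>P) / ((b - a) * real (Suc m))"
proof -
  define y where "y x = (\<lambda>k. g ((S ^^ k) x))" for x
  have [measurable]: "g \<in> borel_measurable P" using g by auto
  \<comment> \<open>Only finitely many averages at a time, so that the gains are integrable; the
    resulting bound does not depend on \<open>k\<close> and survives the increasing union.\<close>
  define E where "E k = {x \<in> space P. \<exists>N\<le>k. upcross (y x) a b m N}" for k
  have E: "E k \<in> events" for k unfolding E_def y_def by measurable
  define c where "c = (b - a) * real (Suc m)"
  have c: "0 < c" using ab by (simp add: c_def)
  have "prob (E k) \<le> (\<integral>x. max 0 (g x - a) \<partial>P) / c" for k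
  proof -
    define h where "h x = gain_out (y x) a b k" for x
    have h: "integrable P h" unfolding h_def y_def using integrable_gains[OF g] by blast
    define H where "H x = h (S x) - h x + max 0 (g x - a)" for x
    have iH: "integrable P H"
      unfolding H_def using h integral_S[OF h] g by auto
    have "integral\<^sup>L P H = (\<integral>x. h (S x) \<partial>P) - integral\<^sup>L P h + (\<integral>x. max 0 (g x - a) \<partial>P)"
      unfolding H_def using h integral_S[OF h] g by simp
    also have "\<dots> = (\<integral>x. max 0 (g x - a) \<partial>P)" using integral_S[OF h] by simp
    finally have int_H: "integral\<^sup>L P H = (\<integral>x. max 0 (g x - a) \<partial>P)" .
    have yS: "y (S x) = (\<lambda>i. y x (Suc i))" for x
      by (simp add: y_def fun_eq_iff funpow_swap1)
    have H_eq: "H x = gain_out (\<lambda>i. y x (Suc i)) a b k - gain_out (y x) a b k + max 0 (y x 0 - a)" for x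
      by (simp add: H_def h_def yS) (simp add: y_def)
    \<comment> \<open>Markov's inequality needs \<open>H\<close> nonnegative outside
      \<open>E k\<close> as well; the difference of gains alone does not show this, the count of
      phases does.\<close>
    have "0 \<le> (b - a) * real (Suc (phase (y x) a b (Suc k)) div 2)" for x
      using ab by simp
    then have nn: "0 \<le> H x" for x
      unfolding H_eq using ab by (intro order_trans[OF _ upcrossings_le_gain]) auto
    have "c \<le> H x" if "x \<in> E k" for x
      using that upcross_gain[of a b "y x" m _ k] ab by (auto simp: E_def H_eq c_def)
    then have "E k \<subseteq> {x \<in> space P. c \<le> H x}" by (auto simp: E_def)
    then have "prob (E k) \<le> prob {x \<in> space P. c \<le> H x}"
      using iH by (intro finite_measure_mono) auto
    also have "\<dots> \<le> integral\<^sup>L P H / c"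
      using integral_Markov_inequality_measure[OF iH, of "space P" c] nn c by auto
    finally show ?thesis unfolding int_H .
  qed
  moreover have "incseq E"
    unfolding incseq_def E_def using le_trans by blast
  then have "(\<lambda>k. prob (E k)) \<longlonglongrightarrow> prob (\<Union>k. E k)"
    using E by (intro finite_Lim_measure_incseq) auto
  ultimately have "prob (\<Union>k. E k) \<le> (\<integral>x. max 0 (g x - a) \<partial>P) / c"
    by (intro LIMSEQ_le_const2) auto
  also have "(\<Union>k. E k) = {x \<in> space P. \<exists>N. upcross (y x) a b m N}"
    by (auto simp: E_def)
  finally show ?thesis unfolding y_def c_def .
qed

end

section \<open>From partial maps and functions to total ones on the completed space\<close>

definition total :: "('a \<rightharpoonup> 'a) \<Rightarrow> 'a \<Rightarrow> 'a" where
  "total T x = (case T x of None \<Rightarrow> x | Some y \<Rightarrow> y)"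

context
  fixes M :: "'a::polish_space measure" and T :: "'a \<rightharpoonup> 'a"
  assumes M: "prob_space M" "sets M = sets borel" and T: "measure_preserving M T"
begin

lemma space_M: "space M = UNIV"
  using sets_eq_imp_space_eq[OF M(2)] by simp

lemma AE_dom: "dom T \<in> sets (completion M)" "AE x in completion M. x \<in> dom T"
proof -
  have "pvimage T UNIV = dom T" by (auto simp: pvimage_def)
  moreover have "emeasure (completion M) (pvimage T UNIV) = emeasure M UNIV"
    using T borel_open[OF open_UNIV] unfolding measure_preserving_def by blast
  ultimately have 1: "emeasure (completion M) (dom T) = 1"
    using prob_space.emeasure_space_1[OF M(1)] space_M by simp
  then show dom: "dom T \<in> sets (completion M)" using emeasure_notin_sets by fastforce
  interpret P: prob_space "completion M" by (rule prob_space.prob_space_completion[OF M(1)])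
  show "AE x in completion M. x \<in> dom T"
    using P.AE_in_set_eq_1[OF dom] 1 by (simp add: P.emeasure_eq_measure)
qed

lemma pvimage_sets: "B \<in> sets borel \<Longrightarrow> pvimage T B \<in> sets (completion M)"
proof -
  assume "B \<in> sets borel"
  then have "(\<lambda>x. the (T x)) -` B \<inter> dom T \<in> sets (restrict_space borel (dom T))"
    using T measurable_sets[of "\<lambda>x. the (T x)" "restrict_space borel (dom T)" borel B]
    by (simp add: measure_preserving_def space_restrict_space)
  moreover have "(\<lambda>x. the (T x)) -` B \<inter> dom T = pvimage T B" by (auto simp: pvimage_def)
  ultimately obtain C where "C \<in> sets borel" "pvimage T B = dom T \<inter> C"
    by (auto simp: sets_restrict_space)
  then show ?thesis using AE_dom(1) M(2) by (auto intro: sets_completionI_sets)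
qed

text \<open>Off \<open>dom T\<close> the total map is the identity, which adds only the null set
  \<open>B - dom T\<close> to the preimage.\<close>

lemma total_vimage:
  assumes "B \<in> sets borel"
  shows "total T -` B \<in> sets (completion M)" "emeasure (completion M) (total T -` B) = emeasure M B"
proof -
  have eq: "total T -` B = pvimage T B \<union> (B - dom T)"
    by (auto simp: total_def pvimage_def dom_def split: option.splits)
  have B: "B \<in> sets (completion M)" using assms M(2) by (auto intro: sets_completionI_sets)
  show "total T -` B \<in> sets (completion M)"
    unfolding eq using pvimage_sets[OF assms] B AE_dom(1) by auto
  have "B - dom T \<in> null_sets (completion M)"
    using AE_dom B by (intro AE_iff_null_sets[THEN iffD2]) auto
  then show "emeasure (completion M) (total T -` B) = emeasure M B"
    unfolding eq using pvimage_sets[OF assms] T assms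
    by (simp add: emeasure_Un_null_set measure_preserving_def del: emeasure_completion)
qed

text \<open>Iteration requires this: the preimage of a Borel set is known to lie only in the
  completion, so preimages of completed sets have to be taken next. The null part is handled through
  a Borel null set that contains it.\<close>

lemma total_vimage_completion:
  assumes "A \<in> sets (completion M)"
  shows "total T -` A \<in> sets (completion M) \<and>
    emeasure (completion M) (total T -` A) = emeasure (completion M) A"
proof -
  from assms obtain B N N' where A: "A = B \<union> N" "N \<subseteq> N'" "N' \<in> null_sets M" "B \<in> sets M"
    by (rule sets_completionE) blast
  have "total T -` N' \<in> null_sets (completion M)"
    using A(3) total_vimage[of N'] M(2) by (auto simp: null_sets_def)
  then have N: "total T -` N \<in> null_sets (completion M)"
    using A(2) by (intro null_sets_completion_subset[of "total T -` N" "total T -` N'"] vimage_mono)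
  have N2: "N \<in> null_sets (completion M)"
    using A(2,3) by (intro null_sets_completionI null_sets_completion_subset[of N N']) 
  have B: "emeasure (completion M) B = emeasure M B" using A(4) by simp
  have "total T -` A = total T -` B \<union> total T -` N" unfolding A by auto
  then show ?thesis
    using N N2 B total_vimage[of B] A(4) M(2) unfolding A(1)
    by (auto simp: emeasure_Un_null_set sets_completionI_sets simp del: emeasure_completion)
qed

lemma preserving_total: "preserving (completion M) (total T)"
proof -
  interpret P: prob_space "completion M" by (rule prob_space.prob_space_completion[OF M(1)])
  have m: "total T \<in> completion M \<rightarrow>\<^sub>M completion M"
    by (rule measurableI) (auto simp: space_M total_vimage_completion)
  show ?thesis
  proof
    show "distr (completion M) (completion M) (total T) = completion M"
      by (rule measure_eqI) (auto simp: emeasure_distr[OF m] space_M total_vimage_completion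
        simp del: emeasure_completion)
  qed (rule m)
qed

end

text \<open>Infinite and missing values both become 0; for an integrable \<open>f\<close> defined
  almost everywhere this alters a null set only.\<close>

definition rvalue :: "('a \<rightharpoonup> ereal) \<Rightarrow> 'a \<Rightarrow> real" where
  "rvalue f x = real_of_ereal (case f x of None \<Rightarrow> 0 | Some y \<Rightarrow> y)"

lemma pintegrable_rvalue:
  assumes "pintegrable M f"
  shows "integrable (completion M) (rvalue f)"
    "AE x in completion M. x \<in> dom f \<longrightarrow> f x = Some (ereal (rvalue f x))"
proof -
  define F where "F x = (case f x of None \<Rightarrow> 0 | Some y \<Rightarrow> y)" for x
  have Fabs: "(case f x of None \<Rightarrow> 0 | Some y \<Rightarrow> \<bar>y\<bar>) = \<bar>F x\<bar>" for x
    by (simp add: F_def split: option.split)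
  have F [measurable]: "F \<in> borel_measurable (completion M)"
    and fin: "(\<integral>\<^sup>+x. e2ennreal \<bar>F x\<bar> \<partial>completion M) < \<infinity>"
    using assms by (simp_all add: pintegrable_def Fabs F_def[symmetric])
  have g: "rvalue f = (\<lambda>x. real_of_ereal (F x))" by (simp add: fun_eq_iff rvalue_def F_def)
  have "ennreal (norm (real_of_ereal z)) \<le> e2ennreal \<bar>z\<bar>" for z
    by (cases z) (auto simp: ennreal.abs_eq[symmetric] e2ennreal_ereal)
  then have "(\<integral>\<^sup>+x. ennreal (norm (rvalue f x)) \<partial>completion M) \<le> (\<integral>\<^sup>+x. e2ennreal \<bar>F x\<bar> \<partial>completion M)"
    unfolding g by (intro nn_integral_mono)
  with fin show "integrable (completion M) (rvalue f)"
    unfolding integrable_iff_bounded g by (auto intro: le_less_trans)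
  have "AE x in completion M. e2ennreal \<bar>F x\<bar> \<noteq> \<infinity>"
    using fin by (intro nn_integral_noteq_infinite) auto
  then show "AE x in completion M. x \<in> dom f \<longrightarrow> f x = Some (ereal (rvalue f x))"
  proof eventually_elim
    case (elim x)
    then show ?case
      by (cases "F x") (auto simp: g F_def infinity_ennreal_def top_ereal_def)
  qed
qed

section \<open>Tests from upcrossings\<close>

lemma usig_compose2:
  assumes "usig s n (\<lambda>z. U (pfst z) (psnd z))" "computable f" "computable g"
  shows "usig s n (\<lambda>z. U (f z) (g z))"
  using usig_compose[OF assms(1) computable_pr[OF assms(2,3)]] by simp

text \<open>A sum exceeds a rational iff its two parts exceed rationals whose sum does, so strict
  lower bounds on the terms suffice. The factor \<open>real 1\<close> here and the summand
  \<open>rat_enum (pr 0 0)\<close>, which is 0, in \<open>avg_set\<close> fit the form of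
  \<open>decidable_rat_less\<close>.\<close>

primrec sum_set :: "(nat \<Rightarrow> nat \<Rightarrow> 'a set) \<Rightarrow> nat \<Rightarrow> nat \<Rightarrow> 'a set" where
  "sum_set U 0 = U 0"
| "sum_set U (Suc N) = (\<lambda>j. \<Union>w\<in>{w. rat_enum j * real 1 < rat_enum (pfst w) + rat_enum (psnd w)}.
     sum_set U N (pfst w) \<inter> U (Suc N) (psnd w))"

definition avg_set :: "(nat \<Rightarrow> nat \<Rightarrow> 'a set) \<Rightarrow> nat \<Rightarrow> nat \<Rightarrow> 'a set" where
  "avg_set U N b = (\<Union>j\<in>{j. rat_enum b * real (Suc N) < rat_enum j + rat_enum (pr 0 0)}. sum_set U N j)"

primrec upcross_set ::
    "(nat \<Rightarrow> nat \<Rightarrow> 'a set) \<Rightarrow> (nat \<Rightarrow> nat \<Rightarrow> 'a set) \<Rightarrow> nat \<Rightarrow> nat \<Rightarrow> nat \<Rightarrow> nat \<Rightarrow> 'a set" where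
  "upcross_set U U' a' b 0 = (\<lambda>N. avg_set U N b)"
| "upcross_set U U' a' b (Suc m) = (\<lambda>N. \<Union>w\<in>{w. pfst w < psnd w \<and> psnd w < N}.
     upcross_set U U' a' b m (pfst w) \<inter> (avg_set U' (psnd w) a' \<inter> avg_set U N b))"

context
  fixes s :: "nat \<Rightarrow> 'a::polish_space" and n :: nat
  assumes n: "1 \<le> n" and s: "computable_metric_space s"
begin

lemma usig_sum_set:
  assumes U: "usig s n (\<lambda>z. U (pfst z) (psnd z))"
  shows "usig s n (\<lambda>z. sum_set U (pfst z) (psnd z))"
proof (rule usig_rec[OF n])
  show "usig s n (sum_set U 0)"
    using usig_compose2[OF U computable_const computable_id, of 0] by simp
  show "sum_set U (Suc N) j = (\<Union>w\<in>{w. rat_enum j * real 1 < rat_enum (pfst w) + rat_enum (psnd w)}.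
     sum_set U N (pfst w) \<inter> U (Suc N) (psnd w))" for N j by simp
  show "usig s n (\<lambda>z. \<Union>w\<in>{w. rat_enum (psnd (psnd z)) * real 1 < rat_enum (pfst w) + rat_enum (psnd w)}.
     Sigma0 s n (sec (pr (pfst z) (pfst w))) \<inter> U (Suc (pfst (psnd z))) (psnd w))"
    by (intro usig_UN n usig_Int s usig_Sigma0 usig_compose2[OF U] decidable_imp_ce decidable_rat_less
        computable_compose[OF computable_sec0] comp_intros)
qed

lemma usig_avg_set:
  assumes U: "usig s n (\<lambda>z. U (pfst z) (psnd z))"
  shows "usig s n (\<lambda>z. avg_set U (pfst z) (psnd z))"
  unfolding avg_set_def
  by (intro usig_UN n usig_compose2[OF usig_sum_set[OF U]] decidable_imp_ce decidable_rat_less comp_intros)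

lemma usig_upcross_set:
  assumes U: "usig s n (\<lambda>z. U (pfst z) (psnd z))" and U': "usig s n (\<lambda>z. U' (pfst z) (psnd z))"
  shows "usig s n (\<lambda>z. upcross_set U U' a' b (pfst z) (psnd z))"
proof (rule usig_rec[OF n])
  note avg = usig_compose2[OF usig_avg_set[OF U]] usig_compose2[OF usig_avg_set[OF U']]
  show "usig s n (upcross_set U U' a' b 0)"
    unfolding upcross_set.simps by (intro avg comp_intros)
  show "upcross_set U U' a' b (Suc m) N = (\<Union>w\<in>{w. pfst w < psnd w \<and> psnd w < N}.
     upcross_set U U' a' b m (pfst w) \<inter> (avg_set U' (psnd w) a' \<inter> avg_set U N b))" for m N by simp
  show "usig s n (\<lambda>z. \<Union>w\<in>{w. pfst w < psnd w \<and> psnd w < psnd (psnd z)}.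
     Sigma0 s n (sec (pr (pfst z) (pfst w))) \<inter> (avg_set U' (psnd w) a' \<inter> avg_set U (psnd (psnd z)) b))"
    by (intro usig_UN n usig_Int s usig_Sigma0 avg decidable_imp_ce
        computable_compose[OF computable_sec0] comp_intros)
qed

end

text \<open>
  \<open>x \<in> U k j\<close> stands for \<open>y k > rat_enum j\<close>.  In \<^const>\<open>upcross_set\<close>, \<open>U'\<close> plays the same role for \<open>-y\<close>,
  and \<open>a'\<close> is an index of \<open>-a\<close>.
\<close>

definition represents :: "(nat \<Rightarrow> nat \<Rightarrow> 'a set) \<Rightarrow> 'a \<Rightarrow> (nat \<Rightarrow> real) \<Rightarrow> bool" where
  "represents U x y \<longleftrightarrow> (\<forall>k j. x \<in> U k j \<longleftrightarrow> rat_enum j < y k)"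

lemma psum_Suc: "psum y (Suc N) = psum y N + y N"
  by (simp add: psum_def)

lemma psum_uminus: "psum (\<lambda>k. - y k) N = - psum y N"
  by (simp add: psum_def sum_negf)

lemma mem_sum_set:
  assumes "represents U x y"
  shows "x \<in> sum_set U N j \<longleftrightarrow> rat_enum j < psum y (Suc N)"
proof (induction N arbitrary: j)
  case 0
  then show ?case using assms by (simp add: represents_def psum_def)
next
  case (Suc N)
  have "x \<in> sum_set U (Suc N) j \<longleftrightarrow> (\<exists>p q. rat_enum j < rat_enum p + rat_enum q \<and>
      rat_enum p < psum y (Suc N) \<and> rat_enum q < y (Suc N))" (is "_ \<longleftrightarrow> ?R")
  proof
    assume ?R
    then obtain p q where "rat_enum j < rat_enum p + rat_enum q"
      "rat_enum p < psum y (Suc N)" "rat_enum q < y (Suc N)" by blast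
    then show "x \<in> sum_set U (Suc N) j"
      using assms Suc by (auto simp: represents_def intro!: exI[of _ "pr p q"])
  qed (use assms Suc in \<open>auto simp: represents_def\<close>)
  also have "\<dots> \<longleftrightarrow> rat_enum j < psum y (Suc (Suc N))"
  proof
    assume less: "rat_enum j < psum y (Suc (Suc N))"
    define e where "e = (psum y (Suc (Suc N)) - rat_enum j) / 2"
    have e: "0 < e" using less by (simp add: e_def)
    obtain p where p: "psum y (Suc N) - e < rat_enum p" "rat_enum p < psum y (Suc N)"
      using ex_rat_enum_between[of "psum y (Suc N) - e" "psum y (Suc N)"] e by auto
    obtain q where q: "y (Suc N) - e < rat_enum q" "rat_enum q < y (Suc N)"
      using ex_rat_enum_between[of "y (Suc N) - e" "y (Suc N)"] e by auto
    have "2 * e = psum y (Suc N) + y (Suc N) - rat_enum j"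
      unfolding e_def psum_Suc[of y "Suc N"] by simp
    then have "rat_enum j < rat_enum p + rat_enum q" using p q by linarith
    then show ?R using p q by blast
  qed (auto simp: psum_Suc[of y "Suc N"])
  finally show ?case .
qed

lemma mem_avg_set:
  assumes "represents U x y"
  shows "x \<in> avg_set U N b \<longleftrightarrow> rat_enum b * real (Suc N) < psum y (Suc N)"
proof -
  have "x \<in> avg_set U N b \<longleftrightarrow> (\<exists>j. rat_enum b * real (Suc N) < rat_enum j \<and> rat_enum j < psum y (Suc N))"
    using rat_enum_pr_of_nat[of 0] by (simp add: avg_set_def mem_sum_set[OF assms])
  then show ?thesis by (metis ex_rat_enum_between less_trans)
qed

lemma mem_upcross_set:
  assumes U: "represents U x y" and U': "represents U' x (\<lambda>k. - y k)" and a: "rat_enum a' = - a"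
  shows "x \<in> upcross_set U U' a' b m N \<longleftrightarrow> upcross y a (rat_enum b) m N"
proof (induction m arbitrary: N)
  case 0
  show ?case by (simp only: upcross_set.simps upcross.simps mem_avg_set[OF U])
next
  case (Suc m)
  have a': "x \<in> avg_set U' L a' \<longleftrightarrow> psum y (Suc L) < a * real (Suc L)" for L
    unfolding mem_avg_set[OF U'] psum_uminus a by auto
  have ex: "(\<exists>w. P (pfst w) (psnd w)) \<longleftrightarrow> (\<exists>K L. P K L)" for P
    by (metis pfst_pr psnd_pr)
  have "x \<in> upcross_set U U' a' b (Suc m) N \<longleftrightarrow> (\<exists>w. pfst w < psnd w \<and> psnd w < N \<and>
      upcross y a (rat_enum b) m (pfst w) \<and> psum y (Suc (psnd w)) < a * real (Suc (psnd w)) \<and>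
      rat_enum b * real (Suc N) < psum y (Suc N))"
    by (simp only: upcross_set.simps UN_iff Int_iff Suc.IH a' mem_avg_set[OF U] mem_Collect_eq bex_simps Bex_def conj_assoc)
  also have "\<dots> \<longleftrightarrow> upcross y a (rat_enum b) (Suc m) N"
    unfolding ex[of "\<lambda>K L. K < L \<and> L < N \<and> upcross y a (rat_enum b) m K \<and>
      psum y (Suc L) < a * real (Suc L) \<and> rat_enum b * real (Suc N) < psum y (Suc N)"] upcross.simps
    by blast
  finally show ?case .
qed

text \<open>Decay of order \<open>1 / m\<close> suffices: along \<open>m = K * 2 ^ k\<close> it
  becomes geometric, and this subsequence is computable for any fixed natural number
  \<open>K\<close>, whatever the real \<open>C\<close> is.\<close>

lemma n_random_not_mem:
  assumes V: "usig s n V" and le: "\<And>m. measure M (V m) \<le> C / real (Suc m)"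
    and x: "n_random s M n x"
  shows "\<exists>m. x \<notin> V m"
proof -
  obtain K :: nat where K: "C \<le> real K" using real_arch_simple by blast
  have "measure M (V (K * 2 ^ k)) \<le> (1 / 2) ^ k" for k
  proof -
    have "(1 / 2) ^ k * real (Suc (K * 2 ^ k)) = real K + (1 / 2) ^ k"
      by (simp add: power_one_over field_simps)
    moreover have "(0::real) \<le> (1 / 2) ^ k" by simp
    ultimately have "C \<le> (1 / 2) ^ k * real (Suc (K * 2 ^ k))" using K by linarith
    then have "C / real (Suc (K * 2 ^ k)) \<le> (1 / 2) ^ k"
      by (simp only: pos_divide_le_eq of_nat_0_less_iff zero_less_Suc)
    with le show ?thesis by (rule order_trans)
  qed
  moreover have "usig s n (\<lambda>k. V (K * 2 ^ k))"
    by (intro usig_compose[OF V] comp_intros)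
  ultimately have "n_test s M n (\<lambda>k. V (K * 2 ^ k))"
    by (simp add: n_test_def usig_def)
  then show ?thesis using x unfolding n_random_def by blast
qed

section \<open>Tests that a random point has to pass\<close>

locale effective_system = preserving "completion M" S for M :: "'a::polish_space measure" and S +
  fixes s :: "nat \<Rightarrow> 'a" and n :: nat
  assumes n: "1 \<le> n" and s: "computable_metric_space s" and sets_M: "sets M = sets borel"
begin

lemma space_UNIV: "space M = UNIV"
  using sets_eq_imp_space_eq[OF sets_M] by simp

text \<open>The test sets are Borel, but the event that bounds them is defined through the total map
  and measurable only for the completion; the inclusion holds almost everywhere.\<close>

lemma measure_usig_le:
  assumes "usig s n V" "AE x in completion M. x \<in> V m \<longrightarrow> x \<in> E" "E \<in> sets (completion M)"
  shows "measure M (V m) \<le> prob E"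
proof -
  obtain e where "V m = Sigma0 s n e" using assms(1) unfolding usig_iff by blast
  then have V: "V m \<in> sets M" using Sigma0_borel sets_M by simp
  then have "measure M (V m) = prob (V m)"
    by (simp add: measure_def)
  also have "\<dots> \<le> prob E"
    using assms(2,3) V by (intro finite_measure_mono_AE) auto
  finally show ?thesis .
qed

context
  fixes U :: "nat \<Rightarrow> nat \<Rightarrow> 'a set" and g :: "'a \<Rightarrow> real" and x :: 'a
  assumes U: "usig s n (\<lambda>z. U (pfst z) (psnd z))" and g: "integrable (completion M) g"
    and rep: "AE x in completion M. represents U x (\<lambda>k. g ((S ^^ k) x))"
    and x: "n_random s M n x"
begin

text \<open>Applied to \<open>f\<close> and to \<open>-f\<close>, this excludes infinite values
  along the orbit of a random point. Only then does \<open>U\<close> represent a real sequence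
  there.\<close>

lemma n_random_values:
  "\<exists>m. x \<notin> U k (pr (2 * m) 0)"
proof -
  let ?V = "\<lambda>m. U k (pr (2 * Suc m) 0)"
  have V: "usig s n ?V" by (intro usig_compose2[OF U] comp_intros)
  define h where "h x = \<bar>g ((S ^^ k) x)\<bar>" for x
  have h: "integrable (completion M) h"
    unfolding h_def using integral_funpow[OF g, of k] by auto
  have "measure M (?V m) \<le> integral\<^sup>L (completion M) h / real (Suc m)" for m
  proof -
    have "measure M (?V m) \<le> prob {x \<in> space (completion M). real (Suc m) \<le> h x}"
    proof (rule measure_usig_le[OF V])
      show "AE x in completion M. x \<in> ?V m \<longrightarrow> x \<in> {x \<in> space (completion M). real (Suc m) \<le> h x}"
        using rep unfolding represents_def rat_enum_pr_of_nat
        by eventually_elim (auto simp: rat_enum_pr_of_nat space_UNIV h_def simp del: mult_Suc_right)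
    qed (use borel_measurable_integrable[OF h] in measurable)
    also have "\<dots> \<le> integral\<^sup>L (completion M) h / real (Suc m)"
      by (rule integral_Markov_inequality_measure[OF h sets.top]) (auto simp: h_def)
    finally show ?thesis .
  qed
  from n_random_not_mem[OF V this x] show ?thesis by blast
qed

lemma n_random_averages:
  "\<exists>m. \<forall>N. x \<notin> avg_set U N (pr (2 * m) 0)"
proof -
  let ?V = "\<lambda>m. \<Union>N\<in>{N. True}. avg_set U N (pr (2 * Suc m) 0)"
  have V: "usig s n ?V"
    by (intro usig_UN n usig_compose2[OF usig_avg_set[OF n s U]] comp_intros decidable_imp_ce)
      (simp add: decidable_def computable_const)
  have "measure M (?V m) \<le> (\<integral>x. max 0 (g x - 0) \<partial>completion M) / real (Suc m)" for m
  proof -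
    \<comment> \<open>Here \<open>m\<close> determines the level \<open>b\<close>, while the
      upcrossing index stays 0: a single average above \<open>b\<close>.\<close>
    let ?E = "{x \<in> space (completion M). \<exists>N. upcross (\<lambda>k. g ((S ^^ k) x)) 0 (real (Suc m)) 0 N}"
    have "measure M (?V m) \<le> prob ?E"
    proof (rule measure_usig_le[OF V])
      show "AE x in completion M. x \<in> ?V m \<longrightarrow> x \<in> ?E"
        using rep
        by eventually_elim (auto simp: mem_avg_set rat_enum_pr_of_nat space_UNIV
            simp del: mult_Suc_right of_nat_Suc)
    qed (use g in measurable)
    also have "\<dots> \<le> (\<integral>x. max 0 (g x - 0) \<partial>completion M) / real (Suc m)"
      using prob_upcross_le[OF g, of 0 "real (Suc m)" 0] by simp
    finally show ?thesis .
  qed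
  from n_random_not_mem[OF V this x] show ?thesis by blast
qed

lemma n_random_upcross:
  assumes U': "usig s n (\<lambda>z. U' (pfst z) (psnd z))"
    and rep': "AE x in completion M. represents U' x (\<lambda>k. - g ((S ^^ k) x))"
    and a: "rat_enum a' = - a" "a < rat_enum b"
  shows "\<exists>m. \<forall>N. x \<notin> upcross_set U U' a' b m N"
proof -
  let ?V = "\<lambda>m. \<Union>N\<in>{N. True}. upcross_set U U' a' b m N"
  have V: "usig s n ?V"
    by (intro usig_UN n usig_compose2[OF usig_upcross_set[OF n s U U']] comp_intros decidable_imp_ce)
      (simp add: decidable_def computable_const)
  have "measure M (?V m) \<le> (\<integral>x. max 0 (g x - a) \<partial>completion M) / (rat_enum b - a) / real (Suc m)" for m
  proof -
    let ?E = "{x \<in> space (completion M). \<exists>N. upcross (\<lambda>k. g ((S ^^ k) x)) a (rat_enum b) m N}"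
    have "measure M (?V m) \<le> prob ?E"
    proof (rule measure_usig_le[OF V])
      show "AE x in completion M. x \<in> ?V m \<longrightarrow> x \<in> ?E"
        using rep rep'
        by eventually_elim (auto simp: mem_upcross_set[OF _ _ a(1)] space_UNIV)
    qed (use g in measurable)
    also have "\<dots> \<le> (\<integral>x. max 0 (g x - a) \<partial>completion M) / (rat_enum b - a) / real (Suc m)"
      using prob_upcross_le[OF g a(2), of m] by simp
    finally show ?thesis .
  qed
  from n_random_not_mem[OF V this x] show ?thesis by blast
qed

end

end

lemma piter_total:
  assumes "\<And>k. (total T ^^ k) x \<in> dom T"
  shows "piter T k x = Some ((total T ^^ k) x)"
proof (induction k)
  case (Suc k)
  obtain y where "T ((total T ^^ k) x) = Some y" using assms[of k] by auto
  moreover from this have "total T ((total T ^^ k) x) = y" by (simp only: total_def option.case)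
  ultimately show ?case using Suc by simp
qed simp

theorem theorem4p19:
  fixes s :: "nat \<Rightarrow> 'a::polish_space"
    and M :: "'a measure"
    and T :: "'a \<rightharpoonup> 'a"
    and f :: "'a \<rightharpoonup> ereal"
    and n :: nat
  assumes "computable_mps s M T"
    and "n \<ge> 1"
    and "n_computable s n f"
    and "AE x in M. x \<in> dom f"
    and "pintegrable M f"
  shows "\<forall>x. n_random s M n x \<and> x \<in> (\<Inter>k. pvimage (piter T k) (dom f)) \<longrightarrow>
    (\<exists>L::real. (\<lambda>N. ergodic_avg T f N x) \<longlonglongrightarrow> ereal L)"
proof (intro allI impI, elim conjE)
  fix x assume x: "n_random s M n x" and dom: "x \<in> (\<Inter>k. pvimage (piter T k) (dom f))"
  have M: "prob_space M" "sets M = sets borel" and T: "measure_preserving M T"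
    and s: "computable_metric_space s" and CT: "computable_transformation s T"
    using assms(1) by (auto simp: computable_mps_def computable_prob_space_def)
  define S where "S = total T"
  define g where "g = rvalue f"
  interpret preserving "completion M" S
    unfolding S_def by (rule preserving_total[OF M T])
  interpret effective_system M S s n
    using assms(2) s M(2) by unfold_locales
  have g: "integrable (completion M) g"
    unfolding g_def by (rule pintegrable_rvalue(1)[OF assms(5)])
  obtain u where u: "computable u"
    "\<And>j. pvimage f {y. y > ereal (rat_enum j)} = dom f \<inter> Sigma0 s n (u j)"
    using assms(3) unfolding n_computable_def uniformly_def Sigma0_in_index_def by blast
  obtain v where v: "computable v"
    "\<And>j. pvimage f {y. y < ereal (rat_enum j)} = dom f \<inter> Sigma0 s n (v j)"
    using assms(3) unfolding n_computable_def uniformly_def Sigma0_in_index_def by blast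
  obtain t where t: "computable t"
    "\<And>x y e. T x = Some y \<Longrightarrow> y \<in> Sigma0 s n e \<longleftrightarrow> x \<in> Sigma0 s n (t e)"
    using pvimage_Sigma0[OF CT assms(2)] by blast
  define U where "U k j = Sigma0 s n ((t ^^ k) (u j))" for k j
  \<comment> \<open>\<open>-f > q\<close> means \<open>f < -q\<close>. The union over all rationals
    at most \<open>- rat_enum j\<close> replaces a computable negation on codes.\<close>
  define U' where "U' k j = (\<Union>i\<in>{i. \<not> rat_enum j * real 0 < rat_enum i + rat_enum j}.
    Sigma0 s n ((t ^^ k) (v i)))" for k j
  have U: "usig s n (\<lambda>z. U (pfst z) (psnd z))"
    unfolding U_def
    by (intro usig_Sigma0 computable_funpow t(1) computable_compose[OF u(1)] comp_intros)
  have U': "usig s n (\<lambda>z. U' (pfst z) (psnd z))"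
    unfolding U'_def
    by (intro usig_UN n usig_Sigma0 computable_funpow t(1) computable_compose[OF v(1)]
        decidable_imp_ce decidable_rat_less comp_intros)
  \<comment> \<open>The value \<open>z\<close> may be infinite here, which is why these equivalences
    can be used to rule that out.\<close>
  have mem_U: "x \<in> U k j \<longleftrightarrow> ereal (rat_enum j) < z"
    and mem_U': "x \<in> U' k j \<longleftrightarrow> z < ereal (- rat_enum j)"
    if "piter T k x = Some y" "f y = Some z" for x y z k j
  proof -
    have "x \<in> U k j \<longleftrightarrow> y \<in> Sigma0 s n (u j)"
      unfolding U_def using piter_Sigma0[OF t(2) that(1)] by simp
    also have "\<dots> \<longleftrightarrow> y \<in> pvimage f {y. y > ereal (rat_enum j)}"
      unfolding u(2) using that(2) by auto
    finally show "x \<in> U k j \<longleftrightarrow> ereal (rat_enum j) < z"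
      using that(2) by (auto simp: pvimage_def)
    have "x \<in> Sigma0 s n ((t ^^ k) (v i)) \<longleftrightarrow> z < ereal (rat_enum i)" for i
    proof -
      have "x \<in> Sigma0 s n ((t ^^ k) (v i)) \<longleftrightarrow> y \<in> Sigma0 s n (v i)"
        using piter_Sigma0[OF t(2) that(1)] by simp
      also have "\<dots> \<longleftrightarrow> y \<in> pvimage f {y. y < ereal (rat_enum i)}"
        unfolding v(2) using that(2) by auto
      finally show ?thesis using that(2) by (auto simp: pvimage_def)
    qed
    moreover have "\<not> rat_enum j * real 0 < rat_enum i + rat_enum j \<longleftrightarrow> rat_enum i \<le> - rat_enum j" for i
      by auto
    ultimately have "x \<in> U' k j \<longleftrightarrow> (\<exists>i. rat_enum i \<le> - rat_enum j \<and> z < ereal (rat_enum i))"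
      by (simp only: U'_def UN_iff mem_Collect_eq Bex_def)
    also have "\<dots> \<longleftrightarrow> z < ereal (- rat_enum j)"
    proof
      have "rat_enum j \<in> \<rat>" by (simp add: rat_enum_eq)
      then obtain i where "rat_enum i = - rat_enum j"
        using ex_rat_enum[of "- rat_enum j"] by auto
      then show "z < ereal (- rat_enum j) \<Longrightarrow> \<exists>i. rat_enum i \<le> - rat_enum j \<and> z < ereal (rat_enum i)"
        by (intro exI[of _ i]) simp
    qed (auto elim!: less_le_trans)
    finally show "x \<in> U' k j \<longleftrightarrow> z < ereal (- rat_enum j)" .
  qed
  have represents: "represents U x y \<and> represents U' x (\<lambda>k. - y k)"
    if "\<And>k. \<exists>w. piter T k x = Some w \<and> f w = Some (ereal (y k))" for x y
    unfolding represents_def using mem_U mem_U' that less_minus_iff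
    by (metis ereal_less_eq(3) less_ereal.simps(1))
  have AE_f: "AE x in completion M. f x = Some (ereal (g x))"
    using AE_completion[OF assms(4)] pintegrable_rvalue(2)[OF assms(5)] unfolding g_def by auto
  have AE_T: "AE x in completion M. x \<in> dom T"
    by (rule AE_dom(2)[OF M T])
  have "AE x in completion M. \<forall>k. (S ^^ k) x \<in> dom T \<and> f ((S ^^ k) x) = Some (ereal (g ((S ^^ k) x)))"
    unfolding AE_all_countable using AE_funpow[OF AE_T] AE_funpow[OF AE_f] by auto
  then have rep: "AE x in completion M. represents U x (\<lambda>k. g ((S ^^ k) x)) \<and>
      represents U' x (\<lambda>k. - g ((S ^^ k) x))"
  proof eventually_elim
    case (elim x)
    then have "piter T k x = Some ((S ^^ k) x)" for k
      unfolding S_def by (intro piter_total) blast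
    with elim show ?case by (intro represents) blast
  qed
  then have rep_U: "AE x in completion M. represents U x (\<lambda>k. g ((S ^^ k) x))"
    and rep_U': "AE x in completion M. represents U' x (\<lambda>k. - g ((S ^^ k) x))" by auto
  have g': "integrable (completion M) (\<lambda>x. - g x)" using g by simp

  have "\<exists>w. \<exists>y. piter T k x = Some y \<and> f y = Some (ereal w)" for k
  proof -
    have "x \<in> pvimage (piter T k) (dom f)" using dom by blast
    then obtain y z where yz: "piter T k x = Some y" "f y = Some z"
      by (auto simp: pvimage_def)
    obtain m where "x \<notin> U k (pr (2 * m) 0)"
      using n_random_values[OF U g rep_U x] by blast
    then have "z \<noteq> \<infinity>" using mem_U[OF yz, of "pr (2 * m) 0"] by force
    obtain m where "x \<notin> U' k (pr (2 * m) 0)"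
      using n_random_values[OF U' g' rep_U' x] by blast
    then have "z \<noteq> -\<infinity>" using mem_U'[OF yz, of "pr (2 * m) 0"] by force
    with \<open>z \<noteq> \<infinity>\<close> yz show ?thesis by (cases z) auto
  qed
  then obtain w where w: "\<And>k. \<exists>y. piter T k x = Some y \<and> f y = Some (ereal (w k))" by metis
  have rx: "represents U x w" "represents U' x (\<lambda>k. - w k)" using represents[OF w] by auto
  obtain B where B: "\<And>N. psum w (Suc N) \<le> real B * real (Suc N)"
    using n_random_averages[OF U g rep_U x] unfolding mem_avg_set[OF rx(1)] rat_enum_pr_of_nat not_less
    by blast
  obtain B' where B': "\<And>N. - psum w (Suc N) \<le> real B' * real (Suc N)"
    using n_random_averages[OF U' g' rep_U' x]
    unfolding mem_avg_set[OF rx(2)] rat_enum_pr_of_nat not_less psum_uminus by blast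
  have "\<exists>L. (\<lambda>N. psum w N / real N) \<longlonglongrightarrow> L"
  proof (rule averages_convergent)
    fix N
    have "real B * real (Suc N) \<le> real (max B B') * real (Suc N)"
      "real B' * real (Suc N) \<le> real (max B B') * real (Suc N)"
      by (intro mult_right_mono; simp)+
    then show "\<bar>psum w (Suc N)\<bar> \<le> real (max B B') * real (Suc N)"
      using B[of N] B'[of N] by linarith
  next
    fix a b :: real assume ab: "a \<in> \<rat>" "b \<in> \<rat>" "a < b"
    obtain a' b' where a': "rat_enum a' = - a" and b': "rat_enum b' = b"
      using ex_rat_enum[of "- a"] ex_rat_enum[of b] ab by auto
    show "\<exists>m. \<forall>N. \<not> upcross w a b m N"
      using n_random_upcross[OF U g rep_U x U' rep_U' a', of b'] ab(3)
      unfolding mem_upcross_set[OF rx a'] b' by blast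
  qed
  then obtain L where L: "(\<lambda>N. psum w N / real N) \<longlonglongrightarrow> L" ..
  have "the (f (the (piter T k x))) = ereal (w k)" for k using w[of k] by auto
  then have "ergodic_avg T f N x = ereal (psum w N / real N)" for N
    by (simp add: ergodic_avg_def psum_def)
  with L show "\<exists>L::real. (\<lambda>N. ergodic_avg T f N x) \<longlonglongrightarrow> ereal L" by auto
qed

end
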